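(* Let $G$ be a finite abelian group acting without inversion on a finite graph $Y$, let $X=Y_G$ with vertices labeled $v_1,\dots,v_g$, choose for each $i$ a vertex $w_i\in V_Y$ lying above $v_i$, and let $G_i$ be the stabilizer of $w_i$ and $e_i=\frac{1}{|G_i|}\sum_{h\in G_i}h$. Let $\mathbf{A}=(\mathbf{a}_{ij})\in M_g(\mathbb{C}[G])$ with $\mathbf{a}_{ij}=\ell_i(w_j)$, and let $\mathbf{Q}\in M_g(\mathbb{C}[G])$ be diagonal with $\mathbf{q}_{ii}=(\mathrm{val}_Y(w_i)-1)e_i$. Then $$\eta_Y(u)=\det(\mathbf{I}-\mathbf{A}u+\mathbf{Q}u^2),$$ where $\mathbf{I}$ is the $g\times g$ identity matrix.
   Context: Graphs in Serre's sense (vertices $V_Y$, directed edges $\mathbf{E}_Y$, maps $o,t$, fixed-point-free involution $\varepsilon\mapsto\bar\varepsilon$ with $o(\bar\varepsilon)=t(\varepsilon)$); $\mathrm{val}_Y(w)=|\{\varepsilon:o(\varepsilon)=w\}|$. Acting without inversion means $\sigma\varepsilon\ne\bar\varepsilon$ always. For $w,w'\in V_Y$, $a_w(w')=|\{\varepsilon\in\mathbf{E}_Y:o(\varepsilon)=w',t(\varepsilon)=w\}|$, and $\ell_i(w)=\frac{1}{|G_i|}\sum_{\sigma\in G}a_{w_i}(\sigma w)\sigma^{-1}\in\mathbb{C}[G]$. $C_0(Y)$ is the $\mathbb{C}[G]$-module with $\mathbb{C}$-basis $V_Y$. Let $\mathcal{D},\mathcal{A}$ be the $\mathbb{C}[G]$-linear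 endomorphisms of $C_0(Y)$ with $\mathcal{D}(w)=\mathrm{val}_Y(w)w$, $\mathcal{A}(w)=\sum_{o(\varepsilon)=w}t(\varepsilon)$, $\mathcal{I}$ the identity, $\mathcal{Q}=\mathcal{D}-\mathcal{I}$, and $\Delta(u)=\mathcal{I}-\mathcal{A}u+\mathcal{Q}u^2$, viewed as a $\mathbb{C}[G][u]$-linear endomorphism of $C_0(Y)[u]$ (acting coefficientwise). For a finitely generated projective module $M$ over a commutative ring $R$ and $f\in\mathrm{End}_R(M)$, $\det_R(f)=\det_R(f\oplus\mathrm{id}_N)$ for any $N$ with $M\oplus N$ free of finite rank. $\eta_Y(u)=\det_{\mathbb{C}[G][u]}(\Delta(u))\in\mathbb{C}[G][u]$. *)

theory Defs
  imports
    "HOL-Library.Poly_Mapping"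
    "HOL-Library.Product_Plus"
    "HOL-Computational_Algebra.Polynomial"
    "Jordan_Normal_Form.Determinant"
begin

section \<open>Graphs in the sense of Serre and group actions on them\<close>

record ('v, 'e) sgraph =
  verts :: "'v set"
  edges :: "'e set"
  org :: "'e \<Rightarrow> 'v"
  ter :: "'e \<Rightarrow> 'v"
  bar :: "'e \<Rightarrow> 'e"

locale serre_graph =
  fixes Y :: "('v, 'e) sgraph"
  assumes org_in: "\<epsilon> \<in> edges Y \<Longrightarrow> org Y \<epsilon> \<in> verts Y"
    and ter_in: "\<epsilon> \<in> edges Y \<Longrightarrow> ter Y \<epsilon> \<in> verts Y"
    and bar_in: "\<epsilon> \<in> edges Y \<Longrightarrow> bar Y \<epsilon> \<in> edges Y"
    and bar_bar: "\<epsilon> \<in> edges Y \<Longrightarrow> bar Y (bar Y \<epsilon>) = \<epsilon>"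
    and bar_neq: "\<epsilon> \<in> edges Y \<Longrightarrow> bar Y \<epsilon> \<noteq> \<epsilon>"
    and org_bar: "\<epsilon> \<in> edges Y \<Longrightarrow> org Y (bar Y \<epsilon>) = ter Y \<epsilon>"

locale finite_serre_graph = serre_graph +
  assumes finite_verts: "finite (verts Y)"
    and finite_edges: "finite (edges Y)"

text \<open>An abelian group is a type of class \<^class>\<open>ab_group_add\<close>, hence written additively;
  \<open>act\<^sub>v\<close> and \<open>act\<^sub>e\<close> are its actions on vertices and on directed edges.\<close>

locale graph_action = serre_graph Y
  for Y :: "('v, 'e) sgraph" +
  fixes act\<^sub>v :: "'g::ab_group_add \<Rightarrow> 'v \<Rightarrow> 'v"
    and act\<^sub>e :: "'g \<Rightarrow> 'e \<Rightarrow> 'e"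
  assumes act\<^sub>v_in: "w \<in> verts Y \<Longrightarrow> act\<^sub>v \<sigma> w \<in> verts Y"
    and act\<^sub>v_zero: "w \<in> verts Y \<Longrightarrow> act\<^sub>v 0 w = w"
    and act\<^sub>v_add: "w \<in> verts Y \<Longrightarrow> act\<^sub>v (\<sigma> + \<tau>) w = act\<^sub>v \<sigma> (act\<^sub>v \<tau> w)"
    and act\<^sub>e_in: "\<epsilon> \<in> edges Y \<Longrightarrow> act\<^sub>e \<sigma> \<epsilon> \<in> edges Y"
    and act\<^sub>e_zero: "\<epsilon> \<in> edges Y \<Longrightarrow> act\<^sub>e 0 \<epsilon> = \<epsilon>"
    and act\<^sub>e_add: "\<epsilon> \<in> edges Y \<Longrightarrow> act\<^sub>e (\<sigma> + \<tau>) \<epsilon> = act\<^sub>e \<sigma> (act\<^sub>e \<tau> \<epsilon>)"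
    and org_act: "\<epsilon> \<in> edges Y \<Longrightarrow> org Y (act\<^sub>e \<sigma> \<epsilon>) = act\<^sub>v \<sigma> (org Y \<epsilon>)"
    and ter_act: "\<epsilon> \<in> edges Y \<Longrightarrow> ter Y (act\<^sub>e \<sigma> \<epsilon>) = act\<^sub>v \<sigma> (ter Y \<epsilon>)"
    and bar_act: "\<epsilon> \<in> edges Y \<Longrightarrow> bar Y (act\<^sub>e \<sigma> \<epsilon>) = act\<^sub>e \<sigma> (bar Y \<epsilon>)"

locale graph_action_without_inversion = graph_action +
  assumes no_inversion: "\<epsilon> \<in> edges Y \<Longrightarrow> act\<^sub>e \<sigma> \<epsilon> \<noteq> bar Y \<epsilon>"

definition orbit_of :: "('g \<Rightarrow> 'a \<Rightarrow> 'a) \<Rightarrow> 'a \<Rightarrow> 'a set" where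
  "orbit_of act x = range (\<lambda>\<sigma>. act \<sigma> x)"

definition stab :: "('g \<Rightarrow> 'a \<Rightarrow> 'a) \<Rightarrow> 'a \<Rightarrow> 'g set" where
  "stab act x = {\<sigma>. act \<sigma> x = x}"

text \<open>The structure maps of the quotient graph are images of sets because, by equivariance, the
  image of the orbit of \<open>\<epsilon>\<close> under a structure map is the orbit of the image of \<open>\<epsilon>\<close>.\<close>

definition quotient_graph ::
    "('v, 'e) sgraph \<Rightarrow> ('g \<Rightarrow> 'v \<Rightarrow> 'v) \<Rightarrow> ('g \<Rightarrow> 'e \<Rightarrow> 'e) \<Rightarrow> ('v set, 'e set) sgraph" where
  "quotient_graph Y act\<^sub>v act\<^sub>e =
    \<lparr>verts = orbit_of act\<^sub>v ` verts Y, edges = orbit_of act\<^sub>e ` edges Y,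
     org = (`) (org Y), ter = (`) (ter Y), bar = (`) (bar Y)\<rparr>"

definition val :: "('v, 'e) sgraph \<Rightarrow> 'v \<Rightarrow> nat" where
  "val Y w = card {\<epsilon> \<in> edges Y. org Y \<epsilon> = w}"

definition adj_count :: "('v, 'e) sgraph \<Rightarrow> 'v \<Rightarrow> 'v \<Rightarrow> nat" where
  "adj_count Y w w' = card {\<epsilon> \<in> edges Y. org Y \<epsilon> = w' \<and> ter Y \<epsilon> = w}"


section \<open>The determinant of an endomorphism of a finitely generated projective module\<close>

locale module_on =
  fixes M :: "'m::ab_group_add set"
    and scale :: "'r::comm_ring_1 \<Rightarrow> 'm \<Rightarrow> 'm"
  assumes zero_in: "0 \<in> M"
    and add_in: "x \<in> M \<Longrightarrow> y \<in> M \<Longrightarrow> x + y \<in> M"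
    and scale_in: "x \<in> M \<Longrightarrow> scale r x \<in> M"
    and scale_right_distrib: "x \<in> M \<Longrightarrow> y \<in> M \<Longrightarrow> scale r (x + y) = scale r x + scale r y"
    and scale_left_distrib: "x \<in> M \<Longrightarrow> scale (r + s) x = scale r x + scale s x"
    and scale_scale: "x \<in> M \<Longrightarrow> scale r (scale s x) = scale (r * s) x"
    and scale_one: "x \<in> M \<Longrightarrow> scale 1 x = x"

locale module_endo = module_on M scale
  for M :: "'m::ab_group_add set" and scale :: "'r::comm_ring_1 \<Rightarrow> 'm \<Rightarrow> 'm" +
  fixes f :: "'m \<Rightarrow> 'm"
  assumes endo_in: "x \<in> M \<Longrightarrow> f x \<in> M"
    and endo_add: "x \<in> M \<Longrightarrow> y \<in> M \<Longrightarrow> f (x + y) = f x + f y"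
    and endo_scale: "x \<in> M \<Longrightarrow> f (scale r x) = scale r (f x)"

definition lincomb_on :: "('r \<Rightarrow> 'm \<Rightarrow> 'm::ab_group_add) \<Rightarrow> nat \<Rightarrow> (nat \<Rightarrow> 'm) \<Rightarrow> 'r vec \<Rightarrow> 'm" where
  "lincomb_on scale n b c = (\<Sum>i<n. scale (c $ i) (b i))"

definition free_basis ::
    "'m::ab_group_add set \<Rightarrow> ('r::comm_ring_1 \<Rightarrow> 'm \<Rightarrow> 'm) \<Rightarrow> nat \<Rightarrow> (nat \<Rightarrow> 'm) \<Rightarrow> bool" where
  "free_basis M scale n b \<longleftrightarrow>
    (\<forall>i<n. b i \<in> M) \<and> (\<forall>x\<in>M. \<exists>!c. c \<in> carrier_vec n \<and> x = lincomb_on scale n b c)"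

definition represents ::
    "('r::comm_ring_1 \<Rightarrow> 'm::ab_group_add \<Rightarrow> 'm) \<Rightarrow> nat \<Rightarrow> (nat \<Rightarrow> 'm) \<Rightarrow> ('m \<Rightarrow> 'm) \<Rightarrow> 'r mat \<Rightarrow> bool" where
  "represents scale n b f A \<longleftrightarrow>
    A \<in> carrier_mat n n \<and> (\<forall>j<n. f (b j) = lincomb_on scale n b (col A j))"

definition scale_prod :: "('r \<Rightarrow> 'm \<Rightarrow> 'm) \<Rightarrow> ('r \<Rightarrow> 'n \<Rightarrow> 'n) \<Rightarrow> 'r \<Rightarrow> 'm \<times> 'n \<Rightarrow> 'm \<times> 'n" where
  "scale_prod s t r = map_prod (s r) (t r)"

text \<open>The type \<open>nat \<Rightarrow>\<^sub>0 'r\<close> with \<open>scale_fin\<close> is the free module of countable rank.\<close>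

definition scale_fin :: "'r::comm_ring_1 \<Rightarrow> (nat \<Rightarrow>\<^sub>0 'r) \<Rightarrow> (nat \<Rightarrow>\<^sub>0 'r)" where
  "scale_fin r = Poly_Mapping.map ((*) r)"

text \<open>\<open>d\<close> is the determinant of \<open>f \<oplus> id\<^sub>N\<close> on a free module \<open>M \<oplus> N\<close> of finite rank. A complement
  \<open>N\<close> is a direct summand of a free module of finite rank, hence isomorphic to a submodule of the
  free module of countable rank; so letting \<open>N\<close> range over such submodules loses no generality.\<close>

definition is_proj_det ::
    "'m::ab_group_add set \<Rightarrow> ('r::comm_ring_1 \<Rightarrow> 'm \<Rightarrow> 'm) \<Rightarrow> ('m \<Rightarrow> 'm) \<Rightarrow> 'r \<Rightarrow> bool" where
  "is_proj_det M scale f d \<longleftrightarrow> module_endo M scale f \<and>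
    (\<exists>(N :: (nat \<Rightarrow>\<^sub>0 'r) set) n b A.
      module_on N scale_fin \<and>
      free_basis (M \<times> N) (scale_prod scale scale_fin) n b \<and>
      represents (scale_prod scale scale_fin) n b (map_prod f id) A \<and>
      d = det A)"

definition proj_det ::
    "'m::ab_group_add set \<Rightarrow> ('r::comm_ring_1 \<Rightarrow> 'm \<Rightarrow> 'm) \<Rightarrow> ('m \<Rightarrow> 'm) \<Rightarrow> 'r" where
  "proj_det M scale f = (THE d. is_proj_det M scale f d)"


section \<open>The group ring and the module of 0-chains\<close>

text \<open>Multiplication on \<open>'g \<Rightarrow>\<^sub>0 complex\<close> is convolution. The group element \<open>\<sigma>\<close> is
  \<open>Poly_Mapping.single \<sigma> 1\<close> and the scalar \<open>c\<close> is \<open>Poly_Mapping.single 0 c\<close>.\<close>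

type_synonym 'g group_ring = "'g \<Rightarrow>\<^sub>0 complex"

abbreviation gr_elt :: "'g \<Rightarrow> 'g group_ring" where
  "gr_elt \<sigma> \<equiv> Poly_Mapping.single \<sigma> 1"

abbreviation gr_scalar :: "complex \<Rightarrow> 'g::ab_group_add group_ring" where
  "gr_scalar c \<equiv> Poly_Mapping.single 0 c"

definition chains :: "('v, 'e) sgraph \<Rightarrow> ('v \<Rightarrow>\<^sub>0 complex) set" where
  "chains Y = {x. Poly_Mapping.keys x \<subseteq> verts Y}"

text \<open>The \<open>\<complex>\<close>-linear extension of a map given on the basis of vertices.\<close>

definition lin_ext :: "('v \<Rightarrow> ('v \<Rightarrow>\<^sub>0 complex)) \<Rightarrow> ('v \<Rightarrow>\<^sub>0 complex) \<Rightarrow> ('v \<Rightarrow>\<^sub>0 complex)" where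
  "lin_ext b x = (\<Sum>w\<in>Poly_Mapping.keys x. Poly_Mapping.map ((*) (Poly_Mapping.lookup x w)) (b w))"

definition chain_scale ::
    "('g \<Rightarrow> 'v \<Rightarrow> 'v) \<Rightarrow> 'g group_ring \<Rightarrow> ('v \<Rightarrow>\<^sub>0 complex) \<Rightarrow> ('v \<Rightarrow>\<^sub>0 complex)" where
  "chain_scale act\<^sub>v r =
    lin_ext (\<lambda>w. \<Sum>\<sigma>\<in>Poly_Mapping.keys r. Poly_Mapping.single (act\<^sub>v \<sigma> w) (Poly_Mapping.lookup r \<sigma>))"

definition val_op :: "('v, 'e) sgraph \<Rightarrow> ('v \<Rightarrow>\<^sub>0 complex) \<Rightarrow> ('v \<Rightarrow>\<^sub>0 complex)" where
  "val_op Y = lin_ext (\<lambda>w. Poly_Mapping.single w (of_nat (val Y w)))"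

definition adj_op :: "('v, 'e) sgraph \<Rightarrow> ('v \<Rightarrow>\<^sub>0 complex) \<Rightarrow> ('v \<Rightarrow>\<^sub>0 complex)" where
  "adj_op Y = lin_ext (\<lambda>w. \<Sum>\<epsilon> | \<epsilon> \<in> edges Y \<and> org Y \<epsilon> = w. Poly_Mapping.single (ter Y \<epsilon>) 1)"

definition Q_op :: "('v, 'e) sgraph \<Rightarrow> ('v \<Rightarrow>\<^sub>0 complex) \<Rightarrow> ('v \<Rightarrow>\<^sub>0 complex)" where
  "Q_op Y x = val_op Y x - x"

text \<open>Elements of \<open>C\<^sub>0(Y)[u]\<close> are polynomials in \<open>u\<close> whose coefficients are chains.\<close>

definition poly_chains :: "('v, 'e) sgraph \<Rightarrow> ('v \<Rightarrow>\<^sub>0 complex) poly set" where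
  "poly_chains Y = {p. \<forall>k. coeff p k \<in> chains Y}"

definition poly_chain_scale ::
    "('g \<Rightarrow> 'v \<Rightarrow> 'v) \<Rightarrow> 'g group_ring poly \<Rightarrow> ('v \<Rightarrow>\<^sub>0 complex) poly \<Rightarrow> ('v \<Rightarrow>\<^sub>0 complex) poly" where
  "poly_chain_scale act\<^sub>v r p =
    (\<Sum>i\<le>degree r. \<Sum>j\<le>degree p. monom (chain_scale act\<^sub>v (coeff r i) (coeff p j)) (i + j))"

text \<open>\<open>pCons 0\<close> is multiplication by \<open>u\<close>.\<close>

definition Delta_op :: "('v, 'e) sgraph \<Rightarrow> ('v \<Rightarrow>\<^sub>0 complex) poly \<Rightarrow> ('v \<Rightarrow>\<^sub>0 complex) poly" where
  "Delta_op Y p = p - pCons 0 (map_poly (adj_op Y) p) + pCons 0 (pCons 0 (map_poly (Q_op Y) p))"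

definition eta ::
    "('v, 'e) sgraph \<Rightarrow> ('g::ab_group_add \<Rightarrow> 'v \<Rightarrow> 'v) \<Rightarrow> 'g group_ring poly" where
  "eta Y act\<^sub>v = proj_det (poly_chains Y) (poly_chain_scale act\<^sub>v) (Delta_op Y)"


section \<open>The matrices over the group ring\<close>

definition stab_idem :: "('g::{ab_group_add,finite} \<Rightarrow> 'v \<Rightarrow> 'v) \<Rightarrow> 'v \<Rightarrow> 'g group_ring" where
  "stab_idem act\<^sub>v x =
    gr_scalar (1 / of_nat (card (stab act\<^sub>v x))) * (\<Sum>h\<in>stab act\<^sub>v x. gr_elt h)"

text \<open>\<open>ell Y act\<^sub>v (w i) x\<close> is \<open>\<ell>\<^sub>i(x)\<close>.\<close>

definition ell ::
    "('v, 'e) sgraph \<Rightarrow> ('g::{ab_group_add,finite} \<Rightarrow> 'v \<Rightarrow> 'v) \<Rightarrow> 'v \<Rightarrow> 'v \<Rightarrow> 'g group_ring" where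
  "ell Y act\<^sub>v w\<^sub>i x =
    gr_scalar (1 / of_nat (card (stab act\<^sub>v w\<^sub>i))) *
      (\<Sum>\<sigma>\<in>UNIV. gr_scalar (of_nat (adj_count Y w\<^sub>i (act\<^sub>v \<sigma> x))) * gr_elt (- \<sigma>))"

definition A_mat ::
    "('v, 'e) sgraph \<Rightarrow> ('g::{ab_group_add,finite} \<Rightarrow> 'v \<Rightarrow> 'v) \<Rightarrow> nat \<Rightarrow> (nat \<Rightarrow> 'v) \<Rightarrow> 'g group_ring mat" where
  "A_mat Y act\<^sub>v g w = mat g g (\<lambda>(i, j). ell Y act\<^sub>v (w i) (w j))"

definition Q_mat ::
    "('v, 'e) sgraph \<Rightarrow> ('g::{ab_group_add,finite} \<Rightarrow> 'v \<Rightarrow> 'v) \<Rightarrow> nat \<Rightarrow> (nat \<Rightarrow> 'v) \<Rightarrow> 'g group_ring mat" where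
  "Q_mat Y act\<^sub>v g w = mat g g (\<lambda>(i, j).
    if i = j then gr_scalar (of_nat (val Y (w i)) - 1) * stab_idem act\<^sub>v (w i) else 0)"

end

theory Submission
  imports Defs "HOL-Computational_Algebra.Formal_Power_Series"
begin

text \<open>
  A finitely generated projective module \<open>M\<close> has a dual basis \<open>(p\<^sub>j, \<phi>\<^sub>j)\<close> with
  \<open>x = \<Sum>\<^sub>j \<phi>\<^sub>j(x) p\<^sub>j\<close>, i.e. maps \<open>\<iota> : M \<rightarrow> R\<^sup>n\<close> and \<open>\<pi> : R\<^sup>n \<rightarrow> M\<close> with \<open>\<pi>\<iota> = 1\<close>. With the
  complement \<open>ker \<pi>\<close>, the endomorphism \<open>f \<oplus> id\<close> becomes \<open>1 + \<iota>(f - 1)\<pi>\<close> on \<open>R\<^sup>n\<close>. Every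
  realisation of \<open>M\<close> as a direct summand of a free module arises in this way, and Sylvester's
  identity \<open>det (1 + XY) = det (1 + YX)\<close> shows that the determinant does not depend on the choice.
  For \<open>C\<^sub>0(Y)\<close> the vertices \<open>w\<^sub>i\<close> and the functionals
  \<open>\<phi>\<^sub>i(x) = 1/|G\<^sub>i| \<Sum>\<^sub>\<sigma> x(\<sigma> w\<^sub>i) \<sigma>\<close> form a dual basis, with \<open>\<phi>\<^sub>i(w\<^sub>j) = \<delta>\<^sub>i\<^sub>j e\<^sub>i\<close> and
  \<open>\<phi>\<^sub>i(\<A> w\<^sub>j) = \<ell>\<^sub>i(w\<^sub>j)\<close>; the resulting matrix for \<open>\<Delta>(u)\<close> is \<open>I - A u + Q u\<^sup>2\<close>.
\<close>

section \<open>Sylvester's determinant identity over a commutative ring\<close>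

text \<open>The first column is a unit vector, so splitting off the first row and column leaves a
  block matrix of the same shape with \<open>n\<close> one smaller. Only blocks of width one are
  ever expanded, so the argument tolerates zero divisors, such as those of a group ring.\<close>

lemma det_four_block_one_upper_left:
  fixes D :: "'a::comm_ring_1 mat"
  assumes "B \<in> carrier_mat n m" and D: "D \<in> carrier_mat m m"
  shows "det (four_block_mat (1\<^sub>m n) B (0\<^sub>m m n) D) = det D"
  using assms(1)
proof (induction n arbitrary: B)
  case 0
  have "four_block_mat (1\<^sub>m 0) B (0\<^sub>m m 0) D = D"
    using 0 D by (intro eq_matI) auto
  then show ?case by simp
next
  case (Suc n)
  \<comment> \<open>\<open>B2\<close> is \<open>B\<close> without its top row; that row, preceded by
    the \<open>n\<close> zeros of the identity block, is \<open>B'\<close>.\<close>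
  define B2 where "B2 = mat n m (\<lambda>(i, j). B $$ (Suc i, j))"
  define D' where "D' = four_block_mat (1\<^sub>m n) B2 (0\<^sub>m m n) D"
  have D': "D' \<in> carrier_mat (n + m) (n + m)" using D by (auto simp: D'_def)
  define B' where "B' = mat 1 (n + m) (\<lambda>(i, j). if j < n then 0 else B $$ (0, j - n))"
  have B': "B' \<in> carrier_mat 1 (n + m)" by (simp add: B'_def)
  have "four_block_mat (1\<^sub>m (Suc n)) B (0\<^sub>m m (Suc n)) D
      = four_block_mat (1\<^sub>m 1) B' (0\<^sub>m (n + m) 1) D'"
    using D Suc.prems
    by (intro eq_matI) (auto simp: B'_def D'_def B2_def Suc_diff_le not_less less_Suc_eq_0_disj
        Suc_diff_Suc)
  then have "det (four_block_mat (1\<^sub>m (Suc n)) B (0\<^sub>m m (Suc n)) D)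
      = det (1\<^sub>m 1 :: 'a mat) * det D'"
    using det_four_block_mat_lower_left_zero_col[OF one_carrier_mat B' refl D'] by simp
  also have "det D' = det D"
    unfolding D'_def by (rule Suc.IH) (simp add: B2_def)
  finally show ?case by simp
qed

text \<open>The mirror image: here the last column is a unit vector, so the last row and column are
  split off. \<open>C1\<close> is \<open>C\<close> without its last row, and \<open>C'\<close> is
  that row padded with zeros.\<close>

lemma det_four_block_one_lower_right:
  fixes A :: "'a::comm_ring_1 mat"
  assumes A: "A \<in> carrier_mat n n" and "C \<in> carrier_mat m n"
  shows "det (four_block_mat A (0\<^sub>m n m) C (1\<^sub>m m)) = det A"
  using assms(2)
proof (induction m arbitrary: C)
  case 0
  have "four_block_mat A (0\<^sub>m n 0) C (1\<^sub>m 0) = A"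
    using 0 A by (intro eq_matI) auto
  then show ?case by simp
next
  case (Suc m)
  define C1 where "C1 = mat m n (\<lambda>(i, j). C $$ (i, j))"
  define A' where "A' = four_block_mat A (0\<^sub>m n m) C1 (1\<^sub>m m)"
  have A': "A' \<in> carrier_mat (n + m) (n + m)" using A by (auto simp: A'_def)
  define C' where "C' = mat 1 (n + m) (\<lambda>(i, j). if j < n then C $$ (m, j) else 0)"
  have C': "C' \<in> carrier_mat 1 (n + m)" by (simp add: C'_def)
  have "four_block_mat A (0\<^sub>m n (Suc m)) C (1\<^sub>m (Suc m))
      = four_block_mat A' (0\<^sub>m (n + m) 1) C' (1\<^sub>m 1)"
    using A Suc.prems
    by (intro eq_matI) (auto simp: C'_def A'_def C1_def not_less less_Suc_eq less_diff_conv2)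
  then have "det (four_block_mat A (0\<^sub>m n (Suc m)) C (1\<^sub>m (Suc m)))
      = det A' * det (1\<^sub>m 1 :: 'a mat)"
    using det_four_block_mat_upper_right_zero_col[OF A' refl C' one_carrier_mat] by simp
  also have "det A' = det A"
    unfolding A'_def by (rule Suc.IH) (simp add: C1_def)
  finally show ?case by simp
qed

text \<open>Both \<open>?T * ?U\<close> and \<open>?L * ?V\<close> equal the block matrix with rows
  \<open>1, -X\<close> and \<open>Y, 1\<close>, while \<open>?T\<close> and \<open>?L\<close> are
  triangular with unit diagonal. Comparing determinants involves no division.\<close>

lemma det_one_plus_mult_commute:
  fixes X Y :: "'a::comm_ring_1 mat"
  assumes X: "X \<in> carrier_mat n m" and Y: "Y \<in> carrier_mat m n"
  shows "det (1\<^sub>m n + X * Y) = det (1\<^sub>m m + Y * X)"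
proof -
  let ?U = "four_block_mat (1\<^sub>m n + X * Y) (0\<^sub>m n m) Y (1\<^sub>m m)"
  let ?V = "four_block_mat (1\<^sub>m n) (- X) (0\<^sub>m m n) (1\<^sub>m m + Y * X)"
  let ?L = "four_block_mat (1\<^sub>m n) (0\<^sub>m n m) Y (1\<^sub>m m)"
  let ?T = "four_block_mat (1\<^sub>m n) (- X) (0\<^sub>m m n) (1\<^sub>m m)"
  have XY: "X * Y \<in> carrier_mat n n" and YX: "Y * X \<in> carrier_mat m m"
    using X Y by auto
  have cL: "?L \<in> carrier_mat (n + m) (n + m)" and cT: "?T \<in> carrier_mat (n + m) (n + m)"
    and cU: "?U \<in> carrier_mat (n + m) (n + m)" and cV: "?V \<in> carrier_mat (n + m) (n + m)"
    using X Y by auto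
  have "?T * ?U = ?L * ?V"
  proof -
    have "?T * ?U = four_block_mat (1\<^sub>m n) (- X) Y (1\<^sub>m m)"
      using X Y XY YX
      by (subst mult_four_block_mat[of _ n n _ m _ m _ _ n _ m]) (auto intro!: cong_four_block_mat)
    moreover have "?L * ?V = four_block_mat (1\<^sub>m n) (- X) Y (1\<^sub>m m)"
      using X Y XY YX
      by (subst mult_four_block_mat[of _ n n _ m _ m _ _ n _ m]) (auto intro!: cong_four_block_mat)
    ultimately show ?thesis by simp
  qed
  then have "det ?T * det ?U = det ?L * det ?V"
    by (simp add: det_mult[OF cT cU, symmetric] det_mult[OF cL cV, symmetric])
  moreover have "det ?T = 1" "det ?V = det (1\<^sub>m m + Y * X)"
    using X YX by (auto simp: det_four_block_one_upper_left)
  moreover have "det ?L = 1" "det ?U = det (1\<^sub>m n + X * Y)"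
    using Y XY by (auto simp: det_four_block_one_lower_right)
  ultimately show ?thesis by simp
qed

section \<open>Determinants of endomorphisms via dual bases\<close>

context module_on
begin

lemma scale_zero_left: "x \<in> M \<Longrightarrow> scale 0 x = 0"
  using scale_left_distrib[of x 0 0] by simp

lemma scale_zero_right: "scale r 0 = 0"
  using scale_right_distrib[of 0 0 r] zero_in by simp

lemma scale_minus_one: "x \<in> M \<Longrightarrow> scale (- 1) x = - x"
  using scale_left_distrib[of x 1 "- 1"]
  by (simp add: scale_one scale_zero_left eq_neg_iff_add_eq_0 add.commute)

lemma uminus_in: "x \<in> M \<Longrightarrow> - x \<in> M"
  using scale_in[of x "- 1"] by (simp add: scale_minus_one)

lemma diff_in: "x \<in> M \<Longrightarrow> y \<in> M \<Longrightarrow> x - y \<in> M"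
  using add_in[of x "- y"] by (simp add: uminus_in)

lemma sum_in: "(\<And>i. i \<in> I \<Longrightarrow> h i \<in> M) \<Longrightarrow> sum h I \<in> M"
  by (induction I rule: infinite_finite_induct) (auto simp: zero_in add_in)

lemma scale_sum_right:
  "(\<And>i. i \<in> I \<Longrightarrow> h i \<in> M) \<Longrightarrow> scale r (sum h I) = (\<Sum>i\<in>I. scale r (h i))"
  by (induction I rule: infinite_finite_induct)
    (auto simp: scale_zero_right scale_right_distrib sum_in)

lemma scale_sum_left:
  "x \<in> M \<Longrightarrow> scale (sum h I) x = (\<Sum>i\<in>I. scale (h i) x)"
  by (induction I rule: infinite_finite_induct)
    (auto simp: scale_zero_left scale_left_distrib)

lemma lincomb_add:
  assumes "\<And>i. i < n \<Longrightarrow> b i \<in> M" and "c \<in> carrier_vec n" "d \<in> carrier_vec n"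
  shows "lincomb_on scale n b (c + d) = lincomb_on scale n b c + lincomb_on scale n b d"
  using assms by (simp add: lincomb_on_def scale_left_distrib sum.distrib)

lemma lincomb_smult:
  assumes "\<And>i. i < n \<Longrightarrow> b i \<in> M" and "c \<in> carrier_vec n"
  shows "lincomb_on scale n b (r \<cdot>\<^sub>v c) = scale r (lincomb_on scale n b c)"
  unfolding lincomb_on_def using assms
  by (subst scale_sum_right) (auto simp: scale_in scale_scale)

lemma lincomb_diff:
  assumes "\<And>i. i < n \<Longrightarrow> b i \<in> M" and "c \<in> carrier_vec n" "d \<in> carrier_vec n"
  shows "lincomb_on scale n b (c - d) = lincomb_on scale n b c - lincomb_on scale n b d"
proof -
  have "c = (c - d) + d" using assms by auto
  then have "lincomb_on scale n b c = lincomb_on scale n b ((c - d) + d)" by metis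
  then show ?thesis using assms by (subst (asm) lincomb_add) auto
qed

lemma lincomb_unit:
  assumes "\<And>i. i < n \<Longrightarrow> b i \<in> M" and "j < n"
  shows "lincomb_on scale n b (unit_vec n j) = b j"
proof -
  have "lincomb_on scale n b (unit_vec n j) = (\<Sum>i<n. if i = j then b i else 0)"
    unfolding lincomb_on_def using assms
    by (intro sum.cong) (auto simp: scale_one scale_zero_left)
  then show ?thesis using assms by simp
qed

end

lemma lookup_scale_fin [simp]:
  "Poly_Mapping.lookup (scale_fin r x) k = r * Poly_Mapping.lookup x k"
  by (simp add: scale_fin_def Poly_Mapping.map.rep_eq when_def)

lemma module_on_scale_prod:
  assumes "module_on M s" "module_on N t"
  shows "module_on (M \<times> N) (scale_prod s t)"
proof -
  interpret M: module_on M s by fact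
  interpret N: module_on N t by fact
  show ?thesis
    by unfold_locales
      (auto simp: scale_prod_def zero_prod_def M.zero_in N.zero_in M.add_in N.add_in M.scale_in
        N.scale_in M.scale_right_distrib N.scale_right_distrib M.scale_left_distrib
        N.scale_left_distrib M.scale_scale N.scale_scale M.scale_one N.scale_one)
qed

lemma fst_lincomb_scale_prod:
  "fst (lincomb_on (scale_prod s t) n b c) = lincomb_on s n (\<lambda>i. fst (b i)) c"
  by (simp add: lincomb_on_def fst_sum scale_prod_def)

lemma snd_lincomb_scale_prod:
  "snd (lincomb_on (scale_prod s t) n b c) = lincomb_on t n (\<lambda>i. snd (b i)) c"
  by (simp add: lincomb_on_def snd_sum scale_prod_def)

text \<open>The \<open>p j\<close> may satisfy relations: the matrix of all
  \<open>\<phi> i (p j)\<close> is idempotent, but in general not the identity.\<close>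

locale dual_basis = module_on M scale
  for M :: "'m::ab_group_add set" and scale :: "'r::comm_ring_1 \<Rightarrow> 'm \<Rightarrow> 'm" +
  fixes n :: nat and p :: "nat \<Rightarrow> 'm" and \<phi> :: "nat \<Rightarrow> 'm \<Rightarrow> 'r"
  assumes p_in: "j < n \<Longrightarrow> p j \<in> M"
    and coord_add: "i < n \<Longrightarrow> x \<in> M \<Longrightarrow> y \<in> M \<Longrightarrow> \<phi> i (x + y) = \<phi> i x + \<phi> i y"
    and coord_scale: "i < n \<Longrightarrow> x \<in> M \<Longrightarrow> \<phi> i (scale r x) = r * \<phi> i x"
    and expansion: "x \<in> M \<Longrightarrow> (\<Sum>j<n. scale (\<phi> j x) (p j)) = x"
begin

lemma coord_zero: "i < n \<Longrightarrow> \<phi> i 0 = 0"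
  using coord_add[of i 0 0] zero_in by simp

lemma coord_sum:
  "i < n \<Longrightarrow> (\<And>k. k \<in> K \<Longrightarrow> h k \<in> M) \<Longrightarrow> \<phi> i (sum h K) = (\<Sum>k\<in>K. \<phi> i (h k))"
  by (induction K rule: infinite_finite_induct) (auto simp: coord_zero coord_add sum_in)

lemma coord_diff: "i < n \<Longrightarrow> x \<in> M \<Longrightarrow> y \<in> M \<Longrightarrow> \<phi> i (x - y) = \<phi> i x - \<phi> i y"
  using coord_add[of i "x - y" y] by (simp add: diff_in)

end

text \<open>The matrix of \<open>1 + \<iota> \<circ> (f - 1) \<circ> \<pi>\<close>, where \<open>\<iota> : M \<rightarrow> R\<^sup>n\<close> and \<open>\<pi> : R\<^sup>n \<rightarrow> M\<close> are the maps
  given by \<open>\<phi>\<close> and \<open>p\<close>.\<close>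

definition endo_mat ::
    "nat \<Rightarrow> (nat \<Rightarrow> 'm::ab_group_add) \<Rightarrow> (nat \<Rightarrow> 'm \<Rightarrow> 'r::comm_ring_1) \<Rightarrow> ('m \<Rightarrow> 'm) \<Rightarrow> 'r mat" where
  "endo_mat n p \<phi> f = mat n n (\<lambda>(i, j). (if i = j then 1 else 0) + \<phi> i (f (p j) - p j))"

text \<open>Put \<open>h = f - 1\<close>. The matrix \<open>X\<close> gives \<open>h\<close> from
  the generators \<open>q\<close> to the coordinates \<open>\<phi>\<close>, and \<open>Y\<close>
  gives the \<open>\<psi>\<close>-coordinates of the \<open>p j\<close>. Then
  \<open>1 + X * Y\<close> and \<open>1 + Y * X\<close> are the two matrices in question, and
  Sylvester's identity applies.\<close>

lemma det_endo_mat_unique: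
  fixes scale :: "'r::comm_ring_1 \<Rightarrow> 'm::ab_group_add \<Rightarrow> 'm"
  assumes f: "module_endo M scale f"
    and b: "dual_basis M scale n p \<phi>" and b': "dual_basis M scale m q \<psi>"
  shows "det (endo_mat n p \<phi> f) = det (endo_mat m q \<psi> f)"
proof -
  interpret module_endo M scale f by fact
  interpret P: dual_basis M scale n p \<phi> by fact
  interpret Q: dual_basis M scale m q \<psi> by fact
  define h where "h x = f x - x" for x
  have h_in: "h x \<in> M" if "x \<in> M" for x
    using that by (simp add: h_def diff_in endo_in)
  have h_add: "h (x + y) = h x + h y" if "x \<in> M" "y \<in> M" for x y
    using that by (simp add: h_def endo_add)
  have h_scale: "h (scale r x) = scale r (h x)" if "x \<in> M" for r x
  proof -
    have "scale r (h x + x) = scale r (h x) + scale r x"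
      using that h_in by (simp add: scale_right_distrib)
    then show ?thesis using that by (simp add: h_def endo_scale algebra_simps)
  qed
  have h_zero: "h 0 = 0" using h_add[of 0 0] zero_in by simp
  have h_sum: "h (sum k I) = (\<Sum>i\<in>I. h (k i))" if "\<And>i. i \<in> I \<Longrightarrow> k i \<in> M" for k :: "nat \<Rightarrow> 'm" and I
    using that by (induction I rule: infinite_finite_induct) (auto simp: h_zero h_add sum_in)
  define X where "X = mat n m (\<lambda>(i, j). \<phi> i (h (q j)))"
  define Y where "Y = mat m n (\<lambda>(i, j). \<psi> i (p j))"
  have "X * Y = mat n n (\<lambda>(i, j). \<phi> i (h (p j)))"
  proof (intro eq_matI)
    fix i j assume "i < dim_row (mat n n (\<lambda>(i, j). \<phi> i (h (p j))))"
      and "j < dim_col (mat n n (\<lambda>(i, j). \<phi> i (h (p j))))"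
    then have i: "i < n" and j: "j < n" by auto
    have "(X * Y) $$ (i, j) = (\<Sum>k<m. \<psi> k (p j) * \<phi> i (h (q k)))"
      using i j by (simp add: X_def Y_def scalar_prod_def lessThan_atLeast0 mult.commute)
    \<comment> \<open>Linearity of \<open>\<phi> i\<close> and of \<open>h\<close> gathers the sum
      into the expansion of \<open>p j\<close> in the \<open>q k\<close>.\<close>
    also have "\<dots> = \<phi> i (h (\<Sum>k<m. scale (\<psi> k (p j)) (q k)))"
      using i j
      by (subst h_sum, force intro: scale_in Q.p_in, subst P.coord_sum)
        (auto simp: h_scale h_in scale_in P.coord_scale Q.p_in)
    finally show "(X * Y) $$ (i, j) = mat n n (\<lambda>(i, j). \<phi> i (h (p j))) $$ (i, j)"
      using i j by (simp add: Q.expansion P.p_in)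
  qed (auto simp: X_def Y_def)
  then have XY: "1\<^sub>m n + X * Y = endo_mat n p \<phi> f"
    by (intro eq_matI) (auto simp: endo_mat_def h_def)
  have "Y * X = mat m m (\<lambda>(i, j). \<psi> i (h (q j)))"
  proof (intro eq_matI)
    fix i j assume "i < dim_row (mat m m (\<lambda>(i, j). \<psi> i (h (q j))))"
      and "j < dim_col (mat m m (\<lambda>(i, j). \<psi> i (h (q j))))"
    then have i: "i < m" and j: "j < m" by auto
    have "(Y * X) $$ (i, j) = (\<Sum>k<n. \<phi> k (h (q j)) * \<psi> i (p k))"
      using i j by (simp add: X_def Y_def scalar_prod_def lessThan_atLeast0 mult.commute)
    \<comment> \<open>Here it is \<open>h (q j)\<close> that is expanded, in terms of the
      \<open>p k\<close>.\<close>
    also have "\<dots> = \<psi> i (\<Sum>k<n. scale (\<phi> k (h (q j))) (p k))"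
      using i j by (subst Q.coord_sum) (auto simp: scale_in Q.coord_scale P.p_in)
    finally show "(Y * X) $$ (i, j) = mat m m (\<lambda>(i, j). \<psi> i (h (q j))) $$ (i, j)"
      using i j by (simp add: P.expansion Q.p_in h_in)
  qed (auto simp: X_def Y_def)
  then have YX: "1\<^sub>m m + Y * X = endo_mat m q \<psi> f"
    by (intro eq_matI) (auto simp: endo_mat_def h_def)
  show ?thesis
    using det_one_plus_mult_commute[of X n m Y] unfolding XY YX by (simp add: X_def Y_def)
qed

text \<open>Given a basis \<open>b\<close> of \<open>M \<times> N\<close>, the first components of
  the \<open>b j\<close> generate \<open>M\<close>, and the coordinates of \<open>(x, 0)\<close>
  serve as functionals on \<open>M\<close>. With these choices \<open>A\<close> is literally the
  matrix \<open>endo_mat n p \<phi> f\<close>, not just similar to it.\<close>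

lemma is_proj_det_imp_dual_basis:
  fixes scale :: "'r::comm_ring_1 \<Rightarrow> 'm::ab_group_add \<Rightarrow> 'm"
  assumes "is_proj_det M scale f d"
  obtains n p \<phi> where "dual_basis M scale n p \<phi>" "d = det (endo_mat n p \<phi> f)"
proof -
  obtain N :: "(nat \<Rightarrow>\<^sub>0 'r) set" and n b A where f: "module_endo M scale f"
    and N: "module_on N scale_fin"
    and fb: "free_basis (M \<times> N) (scale_prod scale scale_fin) n b"
    and rep: "represents (scale_prod scale scale_fin) n b (map_prod f id) A"
    and d: "d = det A"
    using assms unfolding is_proj_det_def by blast
  interpret module_endo M scale f by fact
  interpret N: module_on N scale_fin by fact
  interpret MN: module_on "M \<times> N" "scale_prod scale scale_fin"
    by (intro module_on_scale_prod module_on_axioms N)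
  let ?L = "lincomb_on (scale_prod scale scale_fin) n b"
  have b_in: "b i \<in> M \<times> N" if "i < n" for i
    using conjunct1[OF fb[unfolded free_basis_def]] that by blast
  have coords_ex: "\<exists>!c. c \<in> carrier_vec n \<and> x = ?L c" if "x \<in> M \<times> N" for x
    by (rule bspec[OF conjunct2[OF fb[unfolded free_basis_def]] that])
  define C where "C x = (THE c. c \<in> carrier_vec n \<and> (x, 0) = ?L c)" for x
  have C: "C x \<in> carrier_vec n \<and> (x, 0) = ?L (C x)" if "x \<in> M" for x
  proof -
    have "(x, 0) \<in> M \<times> N" using that N.zero_in by simp
    from theI'[OF coords_ex[OF this]] show ?thesis unfolding C_def .
  qed
  have C_eq: "C x = c" if "x \<in> M" "c \<in> carrier_vec n" "(x, 0) = ?L c" for x c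
  proof -
    have "(x, 0) \<in> M \<times> N" using that(1) N.zero_in by simp
    from coords_ex[OF this] conjI[OF that(2,3)] show ?thesis
      unfolding C_def by (rule the1_equality)
  qed
  define p where "p j = fst (b j)" for j
  define \<phi> where "\<phi> i x = C x $ i" for i x
  have p_in: "p j \<in> M" if "j < n" for j
    using b_in[OF that] by (auto simp: p_def)
  have "dual_basis M scale n p \<phi>"
  proof unfold_locales
    fix i x y assume i: "i < n" and x: "x \<in> M" and y: "y \<in> M"
    have "C (x + y) = C x + C y"
    proof (rule C_eq)
      have "?L (C x + C y) = ?L (C x) + ?L (C y)"
        using C x y b_in by (intro MN.lincomb_add) auto
      then show "(x + y, 0) = ?L (C x + C y)" 
        using C[OF x, THEN conjunct2, symmetric] C[OF y, THEN conjunct2, symmetric] by simp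
    qed (use x y C add_in in auto)
    then show "\<phi> i (x + y) = \<phi> i x + \<phi> i y"
      using i C[OF x] C[OF y] by (auto simp: \<phi>_def)
  next
    fix i r x assume i: "i < n" and x: "x \<in> M"
    have "C (scale r x) = r \<cdot>\<^sub>v C x"
    proof (rule C_eq)
      have "?L (r \<cdot>\<^sub>v C x) = scale_prod scale scale_fin r (?L (C x))"
        using C x b_in by (intro MN.lincomb_smult) auto
      then show "(scale r x, 0) = ?L (r \<cdot>\<^sub>v C x)" 
        using C[OF x, THEN conjunct2, symmetric] by (simp add: scale_prod_def N.scale_zero_right)
    qed (use x C scale_in in auto)
    then show "\<phi> i (scale r x) = r * \<phi> i x"
      using i C[OF x] by (auto simp: \<phi>_def)
  next
    fix x assume x: "x \<in> M"
    have "x = fst (?L (C x))" using C[OF x] by (metis fst_conv)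
    then show "(\<Sum>j<n. scale (\<phi> j x) (p j)) = x"
      unfolding fst_lincomb_scale_prod by (simp add: lincomb_on_def \<phi>_def p_def)
  qed (use p_in in auto)
  moreover have "A = endo_mat n p \<phi> f"
  proof (rule eq_matI)
    have A: "A \<in> carrier_mat n n" using rep by (simp add: represents_def)
    then show "dim_row A = dim_row (endo_mat n p \<phi> f)" "dim_col A = dim_col (endo_mat n p \<phi> f)"
      by (auto simp: endo_mat_def)
    fix i j assume "i < dim_row (endo_mat n p \<phi> f)" "j < dim_col (endo_mat n p \<phi> f)"
    then have i: "i < n" and j: "j < n" by (auto simp: endo_mat_def)
    \<comment> \<open>The identity on \<open>N\<close> cancels in
      \<open>map_prod f id (b j) - b j\<close>, which leaves \<open>(f (p j) - p j, 0)\<close>; its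
      coordinates are therefore column \<open>j\<close> of \<open>A - 1\<close>.\<close>
    have "C (f (p j) - p j) = col A j - unit_vec n j"
    proof (rule C_eq)
      have "?L (col A j - unit_vec n j) = map_prod f id (b j) - b j"
        using rep A b_in j MN.lincomb_unit[of n b j]
        by (subst MN.lincomb_diff) (auto simp: represents_def)
      then show "(f (p j) - p j, 0) = ?L (col A j - unit_vec n j)"
        by (cases "b j") (simp add: p_def)
    qed (use A j p_in endo_in diff_in in auto)
    then have "\<phi> i (f (p j) - p j) = A $$ (i, j) - (if i = j then 1 else 0)"
      using A i j by (simp add: \<phi>_def)
    then show "A $$ (i, j) = endo_mat n p \<phi> f $$ (i, j)"
      using i j by (simp add: endo_mat_def)
  qed
  ultimately show ?thesis using that d by blast
qed

text \<open>The complement is the kernel \<open>N\<close> of \<open>\<pi>\<close>, realised by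
  finitely supported sequences that vanish from position \<open>n\<close> on. The map
  \<open>(x, c) \<mapsto> \<iota> x + c\<close> is an isomorphism from \<open>M \<times> N\<close>
  to the free module of rank \<open>n\<close>, with inverse
  \<open>e \<mapsto> (\<pi> e, e - \<iota> (\<pi> e))\<close>.\<close>

lemma dual_basis_imp_is_proj_det:
  fixes scale :: "'r::comm_ring_1 \<Rightarrow> 'm::ab_group_add \<Rightarrow> 'm"
  assumes f: "module_endo M scale f" and b: "dual_basis M scale n p \<phi>"
  shows "is_proj_det M scale f (det (endo_mat n p \<phi> f))"
proof -
  interpret module_endo M scale f by fact
  interpret dual_basis M scale n p \<phi> by fact
  define \<pi> where "\<pi> c = (\<Sum>j<n. scale (Poly_Mapping.lookup c j) (p j))" for c :: "nat \<Rightarrow>\<^sub>0 'r"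
  define \<iota> where "\<iota> x = (\<Sum>j<n. Poly_Mapping.single j (\<phi> j x))" for x
  define N where "N = {c :: nat \<Rightarrow>\<^sub>0 'r. Poly_Mapping.keys c \<subseteq> {..<n} \<and> \<pi> c = 0}"
  define vec_fin where "vec_fin a = (\<Sum>j<n. Poly_Mapping.single j (a $ j))" for a :: "'r vec"
  have lookup_\<iota>: "Poly_Mapping.lookup (\<iota> x) k = (if k < n then \<phi> k x else 0)" for x k
    by (simp add: \<iota>_def lookup_sum lookup_single when_def)
  have lookup_vec_fin: "Poly_Mapping.lookup (vec_fin a) k = (if k < n then a $ k else 0)" for a k
    by (simp add: vec_fin_def lookup_sum lookup_single when_def)
  have in_keys: "Poly_Mapping.keys c \<subseteq> {..<n} \<longleftrightarrow> (\<forall>k\<ge>n. Poly_Mapping.lookup c k = 0)"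
    for c :: "nat \<Rightarrow>\<^sub>0 'r"
    by (auto simp: subset_iff in_keys_iff not_less[symmetric])
  have \<pi>_in: "\<pi> c \<in> M" for c
    by (auto simp: \<pi>_def intro!: sum_in scale_in p_in)
  have \<pi>_add: "\<pi> (c + d) = \<pi> c + \<pi> d" for c d
    by (simp add: \<pi>_def lookup_add scale_left_distrib p_in sum.distrib)
  have \<pi>_diff: "\<pi> (c - d) = \<pi> c - \<pi> d" for c d
    using \<pi>_add[of "c - d" d] by simp
  have \<pi>_scale: "\<pi> (scale_fin r c) = scale r (\<pi> c)" for r c
    unfolding \<pi>_def by (subst scale_sum_right) (auto simp: scale_in p_in scale_scale)
  have \<pi>_\<iota>: "\<pi> (\<iota> x) = x" if "x \<in> M" for x
    using expansion[OF that] by (simp add: \<pi>_def lookup_\<iota>)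
  have \<pi>_vec_fin: "\<pi> (vec_fin a) = lincomb_on scale n p a" for a
    by (simp add: \<pi>_def lookup_vec_fin lincomb_on_def)
  have \<pi>_single: "\<pi> (Poly_Mapping.single j 1) = p j" if "j < n" for j
  proof -
    have "\<pi> (Poly_Mapping.single j 1) = (\<Sum>i<n. if i = j then p i else 0)"
      unfolding \<pi>_def
      by (intro sum.cong) (auto simp: lookup_single when_def scale_one scale_zero_left p_in)
    then show ?thesis using that by simp
  qed
  have N: "module_on N scale_fin"
  proof unfold_locales
    show "0 \<in> N" using \<pi>_diff[of 0 0] by (simp add: N_def)
  next
    fix x y assume "x \<in> N" "y \<in> N"
    then show "x + y \<in> N" by (auto simp: N_def in_keys lookup_add \<pi>_add)
  next
    fix x r assume "x \<in> N"
    then show "scale_fin r x \<in> N" by (auto simp: N_def in_keys \<pi>_scale scale_zero_right)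
  qed (auto intro!: poly_mapping_eqI simp: lookup_add algebra_simps)
  interpret N: module_on N scale_fin by (fact N)
  interpret MN: module_on "M \<times> N" "scale_prod scale scale_fin"
    by (intro module_on_scale_prod module_on_axioms N)
  \<comment> \<open>The preimage of the \<open>j\<close>-th unit vector under
    \<open>(x, c) \<mapsto> \<iota> x + c\<close>, using \<open>\<pi>_single\<close>.\<close>
  define b where "b j = (p j, Poly_Mapping.single j 1 - \<iota> (p j))" for j
  have b_in: "b j \<in> M \<times> N" if "j < n" for j
    using that
    by (auto simp: b_def N_def p_in in_keys lookup_minus lookup_\<iota> lookup_single \<pi>_diff \<pi>_\<iota> \<pi>_single
        when_def)
  have \<iota>_lincomb: "\<iota> (lincomb_on scale n p a) = (\<Sum>j<n. scale_fin (a $ j) (\<iota> (p j)))" for a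
  proof (rule poly_mapping_eqI)
    fix k
    have "\<phi> k (lincomb_on scale n p a) = (\<Sum>j<n. a $ j * \<phi> k (p j))" if "k < n"
      unfolding lincomb_on_def using that
      by (subst coord_sum) (auto simp: coord_scale scale_in p_in)
    then show "Poly_Mapping.lookup (\<iota> (lincomb_on scale n p a)) k
        = Poly_Mapping.lookup (\<Sum>j<n. scale_fin (a $ j) (\<iota> (p j))) k"
      by (simp add: lookup_\<iota> lookup_sum)
  qed
  \<comment> \<open>Taking combinations of the \<open>b j\<close> is the inverse isomorphism,
    written on coordinate vectors.\<close>
  have lincomb_b: "lincomb_on (scale_prod scale scale_fin) n b a
      = (lincomb_on scale n p a, vec_fin a - \<iota> (lincomb_on scale n p a))" (is "?L a = _") for a
  proof (rule prod_eqI)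
    show "fst (?L a) = fst (lincomb_on scale n p a, vec_fin a - \<iota> (lincomb_on scale n p a))"
      by (simp add: fst_lincomb_scale_prod b_def)
    have "(\<Sum>j<n. scale_fin (a $ j) (Poly_Mapping.single j 1 - \<iota> (p j)))
        = vec_fin a - (\<Sum>j<n. scale_fin (a $ j) (\<iota> (p j)))"
      by (intro poly_mapping_eqI)
        (simp add: lookup_sum lookup_minus vec_fin_def lookup_single algebra_simps sum_subtractf
          mult_when)
    then show "snd (?L a) = snd (lincomb_on scale n p a, vec_fin a - \<iota> (lincomb_on scale n p a))"
      unfolding \<iota>_lincomb snd_lincomb_scale_prod by (simp add: lincomb_on_def b_def)
  qed
  have vec_fin_inj: "a = a'" if "a \<in> carrier_vec n" "a' \<in> carrier_vec n" "vec_fin a = vec_fin a'"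
    for a a'
  proof (rule eq_vecI)
    fix i assume "i < dim_vec a'"
    then show "a $ i = a' $ i"
      using that lookup_vec_fin[of a i] lookup_vec_fin[of a' i] by auto
  qed (use that in auto)
  have "free_basis (M \<times> N) (scale_prod scale scale_fin) n b"
    unfolding free_basis_def
  proof (intro conjI allI impI ballI b_in)
    fix z assume "z \<in> M \<times> N"
    then obtain x c where z: "z = (x, c)" and x: "x \<in> M" and c: "c \<in> N" by auto
    \<comment> \<open>The coordinates of \<open>(x, c)\<close> are the entries of its image
      \<open>c + \<iota> x\<close>. Since \<open>\<pi>\<close> kills \<open>c\<close>, the first
      component of the combination is again \<open>x\<close>.\<close>
    let ?a = "vec n (\<lambda>j. Poly_Mapping.lookup (c + \<iota> x) j)"
    have va: "vec_fin ?a = c + \<iota> x"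
      using c by (intro poly_mapping_eqI)
        (auto simp: lookup_vec_fin N_def in_keys lookup_add lookup_\<iota>)
    have "lincomb_on scale n p ?a = x"
      using c by (simp only: \<pi>_vec_fin[symmetric] va \<pi>_add \<pi>_\<iota>[OF x]) (simp add: N_def)
    then have "z = ?L ?a" by (simp add: lincomb_b va z)
    moreover have "a = ?a" if a: "a \<in> carrier_vec n" "z = ?L a" for a
      using that va by (intro vec_fin_inj) (auto simp: lincomb_b z)
    ultimately show "\<exists>!a. a \<in> carrier_vec n \<and> z = ?L a"
      by (intro ex1I[of _ ?a]) auto
  qed
  moreover have "represents (scale_prod scale scale_fin) n b (map_prod f id) (endo_mat n p \<phi> f)"
    unfolding represents_def
  proof (intro conjI allI impI)
    fix j assume j: "j < n"
    let ?c = "col (endo_mat n p \<phi> f) j"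
    \<comment> \<open>By construction column \<open>j\<close> is the unit vector plus
      \<open>\<iota> (f (p j) - p j)\<close>; applying \<open>\<pi>\<close> gives
      \<open>p j + (f (p j) - p j) = f (p j)\<close>.\<close>
    have vc: "vec_fin ?c = Poly_Mapping.single j 1 + \<iota> (f (p j) - p j)"
      using j by (intro poly_mapping_eqI)
        (auto simp: lookup_vec_fin lookup_add lookup_\<iota> endo_mat_def lookup_single when_def)
    have l: "lincomb_on scale n p ?c = f (p j)"
      using j by (simp only: \<pi>_vec_fin[symmetric] vc \<pi>_add)
        (simp add: \<pi>_single \<pi>_\<iota> diff_in endo_in p_in)
    have "\<iota> (f (p j) - p j) = \<iota> (f (p j)) - \<iota> (p j)"
      using j by (intro poly_mapping_eqI)
        (simp add: lookup_\<iota> lookup_minus coord_diff endo_in p_in)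
    then show "map_prod f id (b j) = ?L ?c"
      unfolding lincomb_b l vc by (simp add: b_def)
  qed (simp add: endo_mat_def)
  ultimately show ?thesis
    unfolding is_proj_det_def using f N by blast
qed

text \<open>The kernel complement gives existence for the definite description. For uniqueness, any
  other realisation yields a dual basis as well, and two dual bases have the same
  determinant.\<close>

theorem proj_det_eq_det_endo_mat:
  assumes "module_endo M scale f" and "dual_basis M scale n p \<phi>"
  shows "proj_det M scale f = det (endo_mat n p \<phi> f)"
  unfolding proj_det_def
proof (rule the_equality)
  show "is_proj_det M scale f (det (endo_mat n p \<phi> f))"
    by (rule dual_basis_imp_is_proj_det[OF assms])
  fix d assume "is_proj_det M scale f d"
  then show "d = det (endo_mat n p \<phi> f)"
    by (metis is_proj_det_imp_dual_basis det_endo_mat_unique[OF assms(1)] assms(2))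
qed

section \<open>Extension of scalars to polynomials\<close>

lemma module_endo_id: "module_on M s \<Longrightarrow> module_endo M s (\<lambda>x. x)"
  by (simp add: module_endo_def module_endo_axioms_def)

lemma module_endo_comp:
  "module_endo M s f \<Longrightarrow> module_endo M s h \<Longrightarrow> module_endo M s (\<lambda>x. f (h x))"
  by (auto simp: module_endo_def module_endo_axioms_def)

lemma module_endo_add:
  assumes "module_endo M s f" "module_endo M s h"
  shows "module_endo M s (\<lambda>x. f x + h x)"
proof -
  interpret f: module_endo M s f by fact
  interpret h: module_endo M s h by fact
  show ?thesis
    by unfold_locales
      (auto simp: f.endo_in h.endo_in f.add_in f.endo_add h.endo_add f.endo_scale h.endo_scale
        f.scale_right_distrib)
qed

lemma module_endo_uminus:
  assumes "module_on M s"
  shows "module_endo M s uminus"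
proof -
  interpret module_on M s by fact
  have "s r (- x) = - s r x" if "x \<in> M" for r x
    using that
    by (metis mult.commute scale_in scale_minus_one scale_scale)
  then show ?thesis
    by unfold_locales (auto simp: uminus_in)
qed

lemma module_endo_diff:
  assumes "module_endo M s f" "module_endo M s h"
  shows "module_endo M s (\<lambda>x. f x - h x)"
proof -
  interpret f: module_endo M s f by fact
  show ?thesis
    using module_endo_add[OF assms(1) module_endo_comp[OF module_endo_uminus assms(2)]]
      f.module_on_axioms by simp
qed

lemma (in module_endo) endo_zero: "f 0 = 0"
  using endo_add[of 0 0] zero_in by simp

text \<open>With \<open>poly_scale\<close> this is the base change of a module to
  \<open>R[u]\<close>. It has the same shape as \<open>poly_chains\<close> and
  \<open>poly_chain_scale\<close>, but for an arbitrary module, so that the extension of scalars is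
  separated from graphs.\<close>

definition poly_set :: "'m::zero set \<Rightarrow> 'm poly set" where
  "poly_set M = {p. \<forall>k. coeff p k \<in> M}"

definition poly_scale ::
    "('r::zero \<Rightarrow> 'm \<Rightarrow> 'm) \<Rightarrow> 'r poly \<Rightarrow> 'm::comm_monoid_add poly \<Rightarrow> 'm poly" where
  "poly_scale s r p = (\<Sum>i\<le>degree r. \<Sum>j\<le>degree p. monom (s (coeff r i) (coeff p j)) (i + j))"

context module_on
begin

text \<open>Summands beyond the degree of either factor vanish, so the degree bounds can be traded
  for the bound \<open>k\<close>. In this Cauchy product form the module laws can be compared
  coefficient by coefficient.\<close>

lemma coeff_poly_scale:
  assumes p: "p \<in> poly_set M"
  shows "coeff (poly_scale scale r p) k = (\<Sum>i\<le>k. scale (coeff r i) (coeff p (k - i)))"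
proof -
  let ?F = "\<lambda>i. scale (coeff r i) (coeff p (k - i))"
  have p_in: "coeff p j \<in> M" for j using p by (simp add: poly_set_def)
  have inner: "(\<Sum>j\<le>degree p. coeff (monom (scale (coeff r i) (coeff p j)) (i + j)) k)
      = (if i \<le> k then ?F i else 0)" for i
  proof (cases "i \<le> k")
    case True
    have "(\<Sum>j\<le>degree p. coeff (monom (scale (coeff r i) (coeff p j)) (i + j)) k)
        = (\<Sum>j\<le>degree p. if j = k - i then ?F i else 0)"
      using True by (intro sum.cong) auto
    also have "\<dots> = ?F i"
      by (auto simp: not_le coeff_eq_0 scale_zero_right)
    finally show ?thesis using True by simp
  next
    case False
    then show ?thesis by (auto intro!: sum.neutral)
  qed
  have "coeff (poly_scale scale r p) k = (\<Sum>i\<le>degree r. if i \<in> {..k} then ?F i else 0)"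
    by (simp add: poly_scale_def coeff_sum inner del: coeff_monom)
  also have "\<dots> = sum ?F ({..degree r} \<inter> {..k})"
    by (rule sum.inter_restrict[symmetric]) simp
  also have "\<dots> = sum ?F {..k}"
  proof (rule sum.mono_neutral_left)
    have "?F i = 0" if "degree r < i" for i
      using that by (simp add: coeff_eq_0 scale_zero_left p_in)
    then show "\<forall>i\<in>{..k} - {..degree r} \<inter> {..k}. ?F i = 0"
      by (metis DiffE IntI atMost_iff not_le)
  qed auto
  finally show ?thesis .
qed

lemma poly_scale_in:
  assumes "p \<in> poly_set M"
  shows "poly_scale scale r p \<in> poly_set M"
proof -
  have "coeff p j \<in> M" for j using assms by (simp add: poly_set_def)
  then have "coeff (poly_scale scale r p) k \<in> M" for k
    unfolding coeff_poly_scale[OF assms] by (intro sum_in scale_in)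
  then show ?thesis by (simp add: poly_set_def)
qed

lemma module_on_poly: "module_on (poly_set M) (poly_scale scale)"
proof unfold_locales
  show "0 \<in> poly_set M" by (simp add: poly_set_def zero_in)
next
  fix x y assume "x \<in> poly_set M" "y \<in> poly_set M"
  then show "x + y \<in> poly_set M" by (simp add: poly_set_def add_in)
next
  fix x r assume "x \<in> poly_set M"
  then show "poly_scale scale r x \<in> poly_set M" by (rule poly_scale_in)
next
  fix r x y assume x: "x \<in> poly_set M" and y: "y \<in> poly_set M"
  then have "x + y \<in> poly_set M" by (simp add: poly_set_def add_in)
  then show "poly_scale scale r (x + y) = poly_scale scale r x + poly_scale scale r y"
    using x y by (intro poly_eqI)
      (simp add: coeff_poly_scale poly_set_def scale_right_distrib sum.distrib)
next
  fix r s x assume x: "x \<in> poly_set M"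
  then show "poly_scale scale (r + s) x = poly_scale scale r x + poly_scale scale s x"
    by (intro poly_eqI) (simp add: coeff_poly_scale poly_set_def scale_left_distrib sum.distrib)
next
  fix x r s assume x: "x \<in> poly_set M"
  then have x_in: "coeff x k \<in> M" for k by (simp add: poly_set_def)
  show "poly_scale scale r (poly_scale scale s x) = poly_scale scale (r * s) x"
  proof (rule poly_eqI)
    fix k
    let ?f = "\<lambda>a b c. scale (coeff r a * coeff s b) (coeff x c)"
    have "coeff (poly_scale scale r (poly_scale scale s x)) k
        = (\<Sum>j\<le>k. scale (coeff r j) (\<Sum>i\<le>k - j. scale (coeff s i) (coeff x (k - j - i))))"
      by (simp add: coeff_poly_scale poly_scale_in x)
    also have "\<dots> = (\<Sum>j\<le>k. \<Sum>i\<le>k - j. ?f j i (k - j - i))"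
      by (intro sum.cong refl, subst scale_sum_right) (simp_all add: scale_in x_in scale_scale)
    \<comment> \<open>Both double sums run over the triples of indices with sum \<open>k\<close>;
      this is the reindexing behind associativity of power series multiplication.\<close>
    also have "\<dots> = (\<Sum>j\<le>k. \<Sum>i\<le>j. ?f i (j - i) (k - j))"
      unfolding atMost_atLeast0 by (rule fps_mult_assoc_lemma[symmetric])
    also have "\<dots> = (\<Sum>j\<le>k. scale (coeff (r * s) j) (coeff x (k - j)))"
      by (simp add: coeff_mult scale_sum_left x_in)
    finally show "coeff (poly_scale scale r (poly_scale scale s x)) k
        = coeff (poly_scale scale (r * s) x) k"
      by (simp add: coeff_poly_scale x)
  qed
next
  fix x assume x: "x \<in> poly_set M"
  then have x_in: "coeff x k \<in> M" for k by (simp add: poly_set_def)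
  show "poly_scale scale 1 x = x"
  proof (rule poly_eqI)
    fix k
    have "coeff (poly_scale scale 1 x) k = (\<Sum>i\<le>k. if i = 0 then coeff x k else 0)"
      unfolding coeff_poly_scale[OF x]
      by (intro sum.cong) (auto simp: scale_one scale_zero_left x_in coeff_1)
    then show "coeff (poly_scale scale 1 x) k = coeff x k" by simp
  qed
qed

lemma module_endo_pCons_zero: "module_endo (poly_set M) (poly_scale scale) (pCons 0)"
proof -
  interpret P: module_on "poly_set M" "poly_scale scale" by (rule module_on_poly)
  have in_poly: "pCons 0 x \<in> poly_set M" if "x \<in> poly_set M" for x
    using that by (auto simp: poly_set_def coeff_pCons zero_in split: nat.split)
  show ?thesis
  proof unfold_locales
    fix x :: "'m poly" and r :: "'r poly" assume x: "x \<in> poly_set M"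
    show "pCons 0 (poly_scale scale r x) = poly_scale scale r (pCons 0 x)"
    proof (rule poly_eqI)
      fix k
      show "coeff (pCons 0 (poly_scale scale r x)) k = coeff (poly_scale scale r (pCons 0 x)) k"
        \<comment> \<open>For a successor \<open>k\<close>, the summand \<open>i = k\<close> meets
          the constant coefficient of \<open>pCons 0 x\<close>, which is zero; in the other summands
          the index shifts by one.\<close>
        by (cases k) (simp_all add: coeff_poly_scale x in_poly Suc_diff_le scale_zero_right)
    qed
  qed (auto simp: in_poly)
qed

end

lemma (in module_endo) module_endo_map_poly:
  "module_endo (poly_set M) (poly_scale scale) (map_poly f)"
proof -
  interpret P: module_on "poly_set M" "poly_scale scale" by (rule module_on_poly)
  have coeff_f: "coeff (map_poly f x) k = f (coeff x k)" for x k
    by (simp add: coeff_map_poly endo_zero)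
  have f_sum: "f (sum h I) = (\<Sum>i\<in>I. f (h i))" if "\<And>i. i \<in> I \<Longrightarrow> h i \<in> M" for h and I :: "nat set"
    using that by (induction I rule: infinite_finite_induct) (auto simp: endo_zero endo_add sum_in)
  have in_poly: "map_poly f x \<in> poly_set M" if "x \<in> poly_set M" for x
    using that by (auto simp: poly_set_def coeff_f endo_in)
  show ?thesis
  proof unfold_locales
    fix x y assume "x \<in> poly_set M" "y \<in> poly_set M"
    then show "map_poly f (x + y) = map_poly f x + map_poly f y"
      by (intro poly_eqI) (simp add: coeff_f poly_set_def endo_add)
  next
    fix x r assume x: "x \<in> poly_set M"
    then have x_in: "coeff x k \<in> M" for k by (simp add: poly_set_def)
    show "map_poly f (poly_scale scale r x) = poly_scale scale r (map_poly f x)"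
      by (intro poly_eqI, simp add: coeff_f coeff_poly_scale x in_poly, subst f_sum)
        (simp_all add: scale_in x_in endo_scale)
  qed (auto simp: in_poly)
qed

text \<open>The expansion holds in each degree separately: \<open>[:p j:]\<close> is constant, so
  only the summand \<open>i = k\<close> of the Cauchy product survives, and coefficient
  \<open>k\<close> is the expansion of \<open>coeff x k\<close> in \<open>M\<close>.\<close>

lemma (in dual_basis) dual_basis_poly:
  "dual_basis (poly_set M) (poly_scale scale) n (\<lambda>j. [:p j:]) (\<lambda>i. map_poly (\<phi> i))"
proof -
  interpret P: module_on "poly_set M" "poly_scale scale" by (rule module_on_poly)
  have coeff_\<phi>: "coeff (map_poly (\<phi> i) x) k = \<phi> i (coeff x k)" if "i < n" for i x k
    using that by (simp add: coeff_map_poly coord_zero)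
  have in_poly: "[:p j:] \<in> poly_set M" if "j < n" for j
    using that by (auto simp: poly_set_def coeff_pCons p_in zero_in split: nat.split)
  show ?thesis
  proof unfold_locales
    fix i x y assume "i < n" "x \<in> poly_set M" "y \<in> poly_set M"
    then show "map_poly (\<phi> i) (x + y) = map_poly (\<phi> i) x + map_poly (\<phi> i) y"
      by (intro poly_eqI) (simp add: coeff_\<phi> poly_set_def coord_add)
  next
    fix i r x assume i: "i < n" and x: "x \<in> poly_set M"
    then have x_in: "coeff x k \<in> M" for k by (simp add: poly_set_def)
    show "map_poly (\<phi> i) (poly_scale scale r x) = r * map_poly (\<phi> i) x"
      by (intro poly_eqI, simp add: coeff_\<phi> i coeff_poly_scale x coeff_mult, subst coord_sum)
        (simp_all add: i scale_in x_in coord_scale)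
  next
    fix x assume x: "x \<in> poly_set M"
    then have x_in: "coeff x k \<in> M" for k by (simp add: poly_set_def)
    show "(\<Sum>j<n. poly_scale scale (map_poly (\<phi> j) x) [:p j:]) = x"
    proof (rule poly_eqI)
      fix k
      have "coeff (poly_scale scale (map_poly (\<phi> j) x) [:p j:]) k = scale (\<phi> j (coeff x k)) (p j)"
        if j: "j < n" for j
      proof -
        have "coeff (poly_scale scale (map_poly (\<phi> j) x) [:p j:]) k
            = (\<Sum>i\<le>k. if i = k then scale (\<phi> j (coeff x k)) (p j) else 0)"
          unfolding coeff_poly_scale[OF in_poly[OF j]]
          by (intro sum.cong)
            (auto simp: coeff_\<phi> j coeff_pCons scale_zero_right split: nat.split)
        then show ?thesis by simp
      qed
      then show "coeff (\<Sum>j<n. poly_scale scale (map_poly (\<phi> j) x) [:p j:]) k = coeff x k"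
        using expansion[OF x_in] by (simp add: coeff_sum)
    qed
  qed (auto simp: in_poly)
qed

section \<open>The module of 0-chains\<close>

lemma lookup_mult_finite:
  fixes r s :: "'g::{ab_group_add,finite} \<Rightarrow>\<^sub>0 'a::semiring_0"
  shows "Poly_Mapping.lookup (r * s) \<sigma>
    = (\<Sum>\<tau>\<in>UNIV. Poly_Mapping.lookup r \<tau> * Poly_Mapping.lookup s (\<sigma> - \<tau>))"
proof -
  have "(\<sigma> = \<tau> + q) = (\<sigma> - \<tau> = q)" for \<tau> q :: 'g by (auto simp: algebra_simps)
  then show ?thesis
    by (simp add: lookup_mult Sum_any.expand_superset[of UNIV] when_def)
qed

text \<open>Enlarging the support to a fixed finite \<open>S\<close> makes the range of summation
  independent of \<open>x\<close>, so that sums for different chains can be compared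
  termwise.\<close>

lemma lookup_lin_ext:
  assumes "finite S" "Poly_Mapping.keys x \<subseteq> S"
  shows "Poly_Mapping.lookup (lin_ext b x) v
    = (\<Sum>w\<in>S. Poly_Mapping.lookup x w * Poly_Mapping.lookup (b w) v)"
proof -
  have "Poly_Mapping.lookup (lin_ext b x) v
      = (\<Sum>w\<in>Poly_Mapping.keys x. Poly_Mapping.lookup x w * Poly_Mapping.lookup (b w) v)"
    by (auto simp: lin_ext_def lookup_sum Poly_Mapping.map.rep_eq when_def intro!: sum.cong)
  also have "\<dots> = (\<Sum>w\<in>S. Poly_Mapping.lookup x w * Poly_Mapping.lookup (b w) v)"
    using assms by (intro sum.mono_neutral_left) (auto simp: in_keys_iff)
  finally show ?thesis .
qed

lemma in_chains_iff: "x \<in> chains Y \<longleftrightarrow> (\<forall>w. w \<notin> verts Y \<longrightarrow> Poly_Mapping.lookup x w = 0)"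
  by (auto simp: chains_def subset_iff in_keys_iff)

definition chain_coord ::
    "('g::{ab_group_add,finite} \<Rightarrow> 'v \<Rightarrow> 'v) \<Rightarrow> 'v \<Rightarrow> ('v \<Rightarrow>\<^sub>0 complex) \<Rightarrow> 'g group_ring" where
  "chain_coord act\<^sub>v w x = (\<Sum>\<sigma>\<in>UNIV. Poly_Mapping.single \<sigma>
    (Poly_Mapping.lookup x (act\<^sub>v \<sigma> w) / of_nat (card (stab act\<^sub>v w))))"

lemma lookup_chain_coord:
  "Poly_Mapping.lookup (chain_coord act\<^sub>v w x) \<sigma>
    = Poly_Mapping.lookup x (act\<^sub>v \<sigma> w) / of_nat (card (stab act\<^sub>v w))"
  by (simp add: chain_coord_def lookup_sum lookup_single when_def)

section \<open>Invariance of the counting functions and the group ring action on chains\<close>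

locale finite_graph_action = finite_serre_graph Y + graph_action Y act\<^sub>v act\<^sub>e
  for Y :: "('v, 'e) sgraph"
    and act\<^sub>v :: "'g::{ab_group_add,finite} \<Rightarrow> 'v \<Rightarrow> 'v" and act\<^sub>e :: "'g \<Rightarrow> 'e \<Rightarrow> 'e"
begin

lemma act\<^sub>v_minus_cancel [simp]:
  "w \<in> verts Y \<Longrightarrow> act\<^sub>v (- \<sigma>) (act\<^sub>v \<sigma> w) = w"
  "w \<in> verts Y \<Longrightarrow> act\<^sub>v \<sigma> (act\<^sub>v (- \<sigma>) w) = w"
  by (simp_all add: act\<^sub>v_add[symmetric] act\<^sub>v_zero)

lemma act\<^sub>e_minus_cancel [simp]:
  "\<epsilon> \<in> edges Y \<Longrightarrow> act\<^sub>e (- \<sigma>) (act\<^sub>e \<sigma> \<epsilon>) = \<epsilon>"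
  "\<epsilon> \<in> edges Y \<Longrightarrow> act\<^sub>e \<sigma> (act\<^sub>e (- \<sigma>) \<epsilon>) = \<epsilon>"
  by (simp_all add: act\<^sub>e_add[symmetric] act\<^sub>e_zero)

lemma bij_act\<^sub>v: "bij_betw (act\<^sub>v \<sigma>) (verts Y) (verts Y)"
  by (rule bij_betw_byWitness[where f' = "act\<^sub>v (- \<sigma>)"]) (auto simp: act\<^sub>v_in)

lemma act\<^sub>v_eq_iff: "w \<in> verts Y \<Longrightarrow> act\<^sub>v \<sigma> w = v \<longleftrightarrow> v \<in> verts Y \<and> w = act\<^sub>v (- \<sigma>) v"
  by (auto simp: act\<^sub>v_in)

lemma adj_count_act:
  assumes "v \<in> verts Y" "w \<in> verts Y"
  shows "adj_count Y (act\<^sub>v \<sigma> v) (act\<^sub>v \<sigma> w) = adj_count Y v w"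
proof -
  have "bij_betw (act\<^sub>e \<sigma>) {\<epsilon> \<in> edges Y. org Y \<epsilon> = w \<and> ter Y \<epsilon> = v}
      {\<epsilon> \<in> edges Y. org Y \<epsilon> = act\<^sub>v \<sigma> w \<and> ter Y \<epsilon> = act\<^sub>v \<sigma> v}"
    by (rule bij_betw_byWitness[where f' = "act\<^sub>e (- \<sigma>)"])
      (auto simp: act\<^sub>e_in org_act ter_act assms)
  from bij_betw_same_card[OF this, symmetric] show ?thesis unfolding adj_count_def .
qed

lemma val_act:
  assumes "w \<in> verts Y"
  shows "val Y (act\<^sub>v \<sigma> w) = val Y w"
proof -
  have "bij_betw (act\<^sub>e \<sigma>) {\<epsilon> \<in> edges Y. org Y \<epsilon> = w} {\<epsilon> \<in> edges Y. org Y \<epsilon> = act\<^sub>v \<sigma> w}"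
    by (rule bij_betw_byWitness[where f' = "act\<^sub>e (- \<sigma>)"]) (auto simp: act\<^sub>e_in org_act assms)
  from bij_betw_same_card[OF this, symmetric] show ?thesis unfolding val_def .
qed

text \<open>For each \<open>\<sigma>\<close>, the only vertex carried to \<open>v\<close> is the
  translate of \<open>v\<close> by \<open>-\<sigma>\<close>, which collapses the sum over vertices.
  Translates of vertices are vertices, hence the value 0 elsewhere.\<close>

lemma lookup_chain_scale:
  assumes "x \<in> chains Y"
  shows "Poly_Mapping.lookup (chain_scale act\<^sub>v r x) v = (if v \<in> verts Y then
    \<Sum>\<sigma>\<in>UNIV. Poly_Mapping.lookup r \<sigma> * Poly_Mapping.lookup x (act\<^sub>v (- \<sigma>) v) else 0)"
proof -
  have b: "Poly_Mapping.lookup (\<Sum>\<sigma>\<in>Poly_Mapping.keys r.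
      Poly_Mapping.single (act\<^sub>v \<sigma> w) (Poly_Mapping.lookup r \<sigma>)) v
      = (\<Sum>\<sigma>\<in>UNIV. if act\<^sub>v \<sigma> w = v then Poly_Mapping.lookup r \<sigma> else 0)" for w
    by (simp add: lookup_sum lookup_single when_def, rule sum.mono_neutral_left)
      (auto simp: in_keys_iff)
  have "Poly_Mapping.lookup (chain_scale act\<^sub>v r x) v = (\<Sum>w\<in>verts Y. \<Sum>\<sigma>\<in>UNIV.
      if act\<^sub>v \<sigma> w = v then Poly_Mapping.lookup r \<sigma> * Poly_Mapping.lookup x w else 0)"
    using assms finite_verts unfolding chain_scale_def
    by (subst lookup_lin_ext[of "verts Y"])
      (auto simp: chains_def b sum_distrib_left intro!: sum.cong)
  also have "\<dots> = (\<Sum>\<sigma>\<in>UNIV. \<Sum>w\<in>verts Y.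
      if act\<^sub>v \<sigma> w = v then Poly_Mapping.lookup r \<sigma> * Poly_Mapping.lookup x w else 0)"
    by (rule sum.swap)
  also have "\<dots> = (\<Sum>\<sigma>\<in>UNIV. \<Sum>w\<in>verts Y. if v \<in> verts Y then
      (if w = act\<^sub>v (- \<sigma>) v then Poly_Mapping.lookup r \<sigma> * Poly_Mapping.lookup x w else 0) else 0)"
    by (intro sum.cong refl) (simp add: act\<^sub>v_eq_iff)
  finally show ?thesis
    using finite_verts by (cases "v \<in> verts Y") (simp_all add: act\<^sub>v_in)
qed

lemma chain_scale_in: "x \<in> chains Y \<Longrightarrow> chain_scale act\<^sub>v r x \<in> chains Y"
  by (simp add: in_chains_iff[of "chain_scale act\<^sub>v r x"] lookup_chain_scale)

lemma module_on_chains: "module_on (chains Y) (chain_scale act\<^sub>v)"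
proof unfold_locales
  show "0 \<in> chains Y" by (simp add: in_chains_iff)
next
  fix x y assume xy: "x \<in> chains Y" "y \<in> chains Y"
  then show xy': "x + y \<in> chains Y" by (simp add: in_chains_iff lookup_add)
  fix r
  show "chain_scale act\<^sub>v r (x + y) = chain_scale act\<^sub>v r x + chain_scale act\<^sub>v r y"
    by (rule poly_mapping_eqI)
      (simp add: lookup_chain_scale xy xy' lookup_add distrib_left sum.distrib)
next
  fix x :: "'v \<Rightarrow>\<^sub>0 complex" and r s :: "'g group_ring" assume x: "x \<in> chains Y"
  show "chain_scale act\<^sub>v r x \<in> chains Y" using x by (rule chain_scale_in)
  show "chain_scale act\<^sub>v (r + s) x = chain_scale act\<^sub>v r x + chain_scale act\<^sub>v s x"
    by (rule poly_mapping_eqI)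
      (simp add: lookup_chain_scale x lookup_add distrib_right sum.distrib)
  show "chain_scale act\<^sub>v 1 x = x"
  proof (rule poly_mapping_eqI)
    fix v
    have "(\<Sum>\<sigma>\<in>UNIV. Poly_Mapping.lookup (1 :: 'g group_ring) \<sigma> * Poly_Mapping.lookup x (act\<^sub>v (- \<sigma>) v))
        = (\<Sum>\<sigma>::'g\<in>UNIV. if \<sigma> = 0 then Poly_Mapping.lookup x (act\<^sub>v 0 v) else 0)"
      by (intro sum.cong) (auto simp: lookup_one when_def)
    then show "Poly_Mapping.lookup (chain_scale act\<^sub>v 1 x) v = Poly_Mapping.lookup x v"
      using x by (simp add: lookup_chain_scale act\<^sub>v_zero in_chains_iff)
  qed
  show "chain_scale act\<^sub>v r (chain_scale act\<^sub>v s x) = chain_scale act\<^sub>v (r * s) x"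
  proof (rule poly_mapping_eqI)
    fix v
    show "Poly_Mapping.lookup (chain_scale act\<^sub>v r (chain_scale act\<^sub>v s x)) v
        = Poly_Mapping.lookup (chain_scale act\<^sub>v (r * s) x) v"
    proof (cases "v \<in> verts Y")
      case v: True
      have "Poly_Mapping.lookup (chain_scale act\<^sub>v r (chain_scale act\<^sub>v s x)) v
          = (\<Sum>\<tau>\<in>UNIV. \<Sum>\<rho>\<in>UNIV. Poly_Mapping.lookup r \<tau> * (Poly_Mapping.lookup s \<rho>
              * Poly_Mapping.lookup x (act\<^sub>v (- \<rho>) (act\<^sub>v (- \<tau>) v))))"
        using v x by (simp add: lookup_chain_scale chain_scale_in act\<^sub>v_in sum_distrib_left)
      \<comment> \<open>Substituting \<open>\<sigma> = \<rho> + \<tau>\<close> makes the convolution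
        product of \<open>r\<close> and \<open>s\<close> appear.\<close>
      also have "\<dots> = (\<Sum>\<tau>\<in>UNIV. \<Sum>\<sigma>\<in>UNIV. Poly_Mapping.lookup r \<tau>
          * (Poly_Mapping.lookup s (\<sigma> - \<tau>) * Poly_Mapping.lookup x (act\<^sub>v (- \<sigma>) v)))"
      proof (rule sum.cong[OF refl])
        fix \<tau> :: 'g
        show "(\<Sum>\<rho>\<in>UNIV. Poly_Mapping.lookup r \<tau> * (Poly_Mapping.lookup s \<rho>
              * Poly_Mapping.lookup x (act\<^sub>v (- \<rho>) (act\<^sub>v (- \<tau>) v))))
            = (\<Sum>\<sigma>\<in>UNIV. Poly_Mapping.lookup r \<tau>
              * (Poly_Mapping.lookup s (\<sigma> - \<tau>) * Poly_Mapping.lookup x (act\<^sub>v (- \<sigma>) v)))"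
          using v by (intro sum.reindex_bij_witness[of _ "\<lambda>\<sigma>. \<sigma> - \<tau>" "\<lambda>\<rho>. \<rho> + \<tau>"])
            (auto simp: act\<^sub>v_add[symmetric])
      qed
      also have "\<dots> = (\<Sum>\<sigma>\<in>UNIV. \<Sum>\<tau>\<in>UNIV. Poly_Mapping.lookup r \<tau>
          * (Poly_Mapping.lookup s (\<sigma> - \<tau>) * Poly_Mapping.lookup x (act\<^sub>v (- \<sigma>) v)))"
        by (rule sum.swap)
      finally show ?thesis
        using v x by (simp add: lookup_chain_scale lookup_mult_finite sum_distrib_right mult.assoc)
    qed (use x in \<open>simp add: lookup_chain_scale chain_scale_in\<close>)
  qed
qed

section \<open>Equivariance of the valency and adjacency operators\<close>

lemma lookup_adj_op:
  assumes "x \<in> chains Y"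
  shows "Poly_Mapping.lookup (adj_op Y x) v
    = (\<Sum>w\<in>verts Y. Poly_Mapping.lookup x w * of_nat (adj_count Y v w))"
proof -
  have "Poly_Mapping.lookup (\<Sum>\<epsilon> | \<epsilon> \<in> edges Y \<and> org Y \<epsilon> = w.
      Poly_Mapping.single (ter Y \<epsilon>) (1::complex)) v = of_nat (adj_count Y v w)" for w
  proof -
    have "{\<epsilon> \<in> edges Y. org Y \<epsilon> = w} \<inter> {\<epsilon>. ter Y \<epsilon> = v} = {\<epsilon> \<in> edges Y. org Y \<epsilon> = w \<and> ter Y \<epsilon> = v}"
      by auto
    then show ?thesis
      using finite_edges
      by (simp add: lookup_sum lookup_single when_def adj_count_def sum.If_cases)
  qed
  then show ?thesis
    using assms finite_verts unfolding adj_op_def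
    by (subst lookup_lin_ext[of "verts Y"]) (auto simp: chains_def)
qed

lemma lookup_val_op:
  assumes "x \<in> chains Y"
  shows "Poly_Mapping.lookup (val_op Y x) v = of_nat (val Y v) * Poly_Mapping.lookup x v"
proof -
  have "Poly_Mapping.lookup (val_op Y x) v
      = (\<Sum>w\<in>verts Y. Poly_Mapping.lookup x w
          * Poly_Mapping.lookup (Poly_Mapping.single w (of_nat (val Y w))) v)"
    unfolding val_op_def
    using assms by (intro lookup_lin_ext finite_verts) (simp add: chains_def)
  also have "\<dots> = (\<Sum>w\<in>verts Y. if w = v then of_nat (val Y v) * Poly_Mapping.lookup x v else 0)"
    by (intro sum.cong) (auto simp: lookup_single when_def)
  finally show ?thesis
    using assms finite_verts by (auto simp: in_chains_iff)
qed

text \<open>The valency is constant on orbits, so this diagonal operator commutes with the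
  action.\<close>

lemma module_endo_val_op: "module_endo (chains Y) (chain_scale act\<^sub>v) (val_op Y)"
proof -
  interpret module_on "chains Y" "chain_scale act\<^sub>v" by (rule module_on_chains)
  have val_in: "val_op Y x \<in> chains Y" if "x \<in> chains Y" for x
    using that by (simp add: in_chains_iff[of "val_op Y x"] lookup_val_op)
      (simp add: in_chains_iff)
  show ?thesis
  proof unfold_locales
    fix x y assume "x \<in> chains Y" "y \<in> chains Y"
    then show "val_op Y (x + y) = val_op Y x + val_op Y y"
      by (intro poly_mapping_eqI) (simp add: lookup_val_op lookup_add add_in distrib_left)
  next
    fix x r assume x: "x \<in> chains Y"
    show "val_op Y (chain_scale act\<^sub>v r x) = chain_scale act\<^sub>v r (val_op Y x)"
      by (intro poly_mapping_eqI)
        (simp add: lookup_val_op lookup_chain_scale x scale_in val_in val_act sum_distrib_left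
          mult.left_commute)
  qed (fact val_in)
qed

lemma module_endo_Q_op: "module_endo (chains Y) (chain_scale act\<^sub>v) (Q_op Y)"
  unfolding Q_op_def[abs_def]
  by (intro module_endo_diff module_endo_val_op module_endo_id module_on_chains)

text \<open>Edge counts are unchanged when both endpoints are translated. Reindexing the vertices by
  \<open>-\<sigma>\<close> therefore moves the group element from the argument of \<open>x\<close>
  to the target \<open>v\<close>.\<close>

lemma module_endo_adj_op: "module_endo (chains Y) (chain_scale act\<^sub>v) (adj_op Y)"
proof -
  interpret module_on "chains Y" "chain_scale act\<^sub>v" by (rule module_on_chains)
  have adj_0: "adj_count Y v w = 0" if "v \<notin> verts Y" for v w
  proof -
    have "{\<epsilon> \<in> edges Y. org Y \<epsilon> = w \<and> ter Y \<epsilon> = v} = {}" using that ter_in by auto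
    then show ?thesis by (simp only: adj_count_def card.empty)
  qed
  have adj_in: "adj_op Y x \<in> chains Y" if "x \<in> chains Y" for x
    using that by (simp add: in_chains_iff[of "adj_op Y x"] lookup_adj_op adj_0)
  show ?thesis
  proof unfold_locales
    fix x y assume "x \<in> chains Y" "y \<in> chains Y"
    then show "adj_op Y (x + y) = adj_op Y x + adj_op Y y"
      by (intro poly_mapping_eqI)
        (simp add: lookup_adj_op lookup_add add_in distrib_right sum.distrib)
  next
    fix x r assume x: "x \<in> chains Y"
    show "adj_op Y (chain_scale act\<^sub>v r x) = chain_scale act\<^sub>v r (adj_op Y x)"
    proof (rule poly_mapping_eqI)
      fix v
      show "Poly_Mapping.lookup (adj_op Y (chain_scale act\<^sub>v r x)) v
          = Poly_Mapping.lookup (chain_scale act\<^sub>v r (adj_op Y x)) v"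
      proof (cases "v \<in> verts Y")
        case v: True
        have "Poly_Mapping.lookup (adj_op Y (chain_scale act\<^sub>v r x)) v
            = (\<Sum>w\<in>verts Y. \<Sum>\<sigma>\<in>UNIV. Poly_Mapping.lookup r \<sigma>
                * (Poly_Mapping.lookup x (act\<^sub>v (- \<sigma>) w) * of_nat (adj_count Y v w)))"
          by (simp add: lookup_adj_op lookup_chain_scale x scale_in sum_distrib_right mult.assoc)
        also have "\<dots> = (\<Sum>\<sigma>\<in>UNIV. \<Sum>w\<in>verts Y. Poly_Mapping.lookup r \<sigma>
                * (Poly_Mapping.lookup x (act\<^sub>v (- \<sigma>) w) * of_nat (adj_count Y v w)))"
          by (rule sum.swap)
        also have "\<dots> = (\<Sum>\<sigma>\<in>UNIV. \<Sum>w\<in>verts Y. Poly_Mapping.lookup r \<sigma>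
                * (Poly_Mapping.lookup x w * of_nat (adj_count Y (act\<^sub>v (- \<sigma>) v) w)))"
        proof (rule sum.cong[OF refl])
          fix \<sigma> :: 'g
          let ?h = "\<lambda>w. Poly_Mapping.lookup r \<sigma>
                * (Poly_Mapping.lookup x w * of_nat (adj_count Y (act\<^sub>v (- \<sigma>) v) w))"
          have "sum ?h (verts Y) = (\<Sum>w\<in>verts Y. ?h (act\<^sub>v (- \<sigma>) w))"
            by (rule sum.reindex_bij_betw[OF bij_act\<^sub>v, symmetric])
          also have "\<dots> = (\<Sum>w\<in>verts Y. Poly_Mapping.lookup r \<sigma>
                * (Poly_Mapping.lookup x (act\<^sub>v (- \<sigma>) w) * of_nat (adj_count Y v w)))"
            using v by (intro sum.cong) (auto simp: adj_count_act)
          finally show "\<dots> = sum ?h (verts Y)" by (rule sym)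
        qed
        finally show ?thesis
          using v x by (simp add: lookup_adj_op lookup_chain_scale adj_in sum_distrib_left)
      qed (simp add: lookup_adj_op lookup_chain_scale x scale_in adj_in adj_0)
    qed
  qed (fact adj_in)
qed

section \<open>Orbit representatives as a dual basis, and the resulting matrix entries\<close>

text \<open>The hypothesis \<open>cover\<close> says that the \<open>w i\<close> represent each
  orbit once. The coefficient at \<open>v\<close> then comes only from the representative
  \<open>w k\<close> of its orbit, as a sum of equal terms, one for each group element carrying
  \<open>w k\<close> to \<open>v\<close>.\<close>

lemma dual_basis_chains:
  assumes w: "\<And>i. i < g \<Longrightarrow> w i \<in> verts Y"
    and cover: "\<And>v. v \<in> verts Y \<Longrightarrow> \<exists>!i. i < g \<and> v \<in> orbit_of act\<^sub>v (w i)"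
  shows "dual_basis (chains Y) (chain_scale act\<^sub>v) g
    (\<lambda>j. Poly_Mapping.single (w j) 1) (\<lambda>i. chain_coord act\<^sub>v (w i))"
proof -
  interpret module_on "chains Y" "chain_scale act\<^sub>v" by (rule module_on_chains)
  have single_in: "Poly_Mapping.single (w j) (1::complex) \<in> chains Y" if "j < g" for j
    using w[OF that] by (simp add: chains_def)
  show ?thesis
  proof unfold_locales
    fix i x y
    show "chain_coord act\<^sub>v (w i) (x + y) = chain_coord act\<^sub>v (w i) x + chain_coord act\<^sub>v (w i) y"
      by (rule poly_mapping_eqI) (simp add: lookup_chain_coord lookup_add add_divide_distrib)
  next
    fix i r x assume i: "i < g" and x: "x \<in> chains Y"
    show "chain_coord act\<^sub>v (w i) (chain_scale act\<^sub>v r x) = r * chain_coord act\<^sub>v (w i) x"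
      by (rule poly_mapping_eqI)
        (simp add: lookup_chain_coord lookup_mult_finite lookup_chain_scale x w[OF i] act\<^sub>v_in
          act\<^sub>v_add[symmetric] sum_divide_distrib)
  next
    fix x assume x: "x \<in> chains Y"
    show "(\<Sum>j<g. chain_scale act\<^sub>v (chain_coord act\<^sub>v (w j) x) (Poly_Mapping.single (w j) 1)) = x"
    proof (rule poly_mapping_eqI)
      fix v
      let ?t = "\<lambda>j. Poly_Mapping.lookup
        (chain_scale act\<^sub>v (chain_coord act\<^sub>v (w j) x) (Poly_Mapping.single (w j) 1)) v"
      have "(\<Sum>j<g. ?t j) = Poly_Mapping.lookup x v"
      proof (cases "v \<in> verts Y")
        case v: True
        have t: "?t j = (\<Sum>\<sigma>\<in>{\<sigma>. act\<^sub>v \<sigma> (w j) = v}.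
            Poly_Mapping.lookup x v / of_nat (card (stab act\<^sub>v (w j))))" if j: "j < g" for j
        proof -
          have "?t j = (\<Sum>\<sigma>\<in>UNIV. if \<sigma> \<in> {\<sigma>. act\<^sub>v \<sigma> (w j) = v} then
              Poly_Mapping.lookup x v / of_nat (card (stab act\<^sub>v (w j))) else 0)"
            unfolding lookup_chain_scale[OF single_in[OF j]]
            using v w[OF j]
            by (auto simp: lookup_chain_coord lookup_single when_def act\<^sub>v_in intro!: sum.cong)
          also have "\<dots> = (\<Sum>\<sigma>\<in>UNIV \<inter> {\<sigma>. act\<^sub>v \<sigma> (w j) = v}.
              Poly_Mapping.lookup x v / of_nat (card (stab act\<^sub>v (w j))))"
            by (rule sum.inter_restrict[symmetric]) simp
          finally show ?thesis by simp
        qed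
        obtain k where k: "k < g" "v \<in> orbit_of act\<^sub>v (w k)"
          and uniq: "\<And>j. j < g \<Longrightarrow> v \<in> orbit_of act\<^sub>v (w j) \<Longrightarrow> j = k"
          using cover[OF v] by blast
        obtain \<tau> where \<tau>: "v = act\<^sub>v \<tau> (w k)" using k by (auto simp: orbit_of_def)
        \<comment> \<open>The elements carrying \<open>w k\<close> to \<open>v\<close> form a coset
          of the stabilizer; the denominator in \<open>chain_coord\<close> compensates for exactly
          this multiplicity.\<close>
        have "card {\<sigma>. act\<^sub>v \<sigma> (w k) = v} = card (stab act\<^sub>v (w k))"
        proof (rule bij_betw_same_card)
          have "act\<^sub>v (\<sigma> - \<tau>) (w k) = w k" if "act\<^sub>v \<sigma> (w k) = act\<^sub>v \<tau> (w k)" for \<sigma>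
            using act\<^sub>v_add[of "w k" "- \<tau>" \<sigma>] that w[OF k(1)] by simp
          moreover have "act\<^sub>v (\<sigma> + \<tau>) (w k) = act\<^sub>v \<tau> (w k)" if "act\<^sub>v \<sigma> (w k) = w k" for \<sigma>
            using act\<^sub>v_add[of "w k" \<tau> \<sigma>] that w[OF k(1)] by (simp add: add.commute)
          ultimately show "bij_betw (\<lambda>\<sigma>. \<sigma> - \<tau>) {\<sigma>. act\<^sub>v \<sigma> (w k) = v} (stab act\<^sub>v (w k))"
            by (intro bij_betw_byWitness[where f' = "\<lambda>\<sigma>. \<sigma> + \<tau>"]) (auto simp: stab_def \<tau>)
        qed
        moreover have "card (stab act\<^sub>v (w k)) \<noteq> 0"
        proof -
          have "0 \<in> stab act\<^sub>v (w k)" using w[OF k(1)] by (simp add: stab_def act\<^sub>v_zero)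
          then show ?thesis by auto
        qed
        ultimately have "?t k = Poly_Mapping.lookup x v"
          using t[OF k(1)] by simp
        moreover have "?t j = 0" if "j < g" "j \<noteq> k" for j
        proof -
          have "{\<sigma>. act\<^sub>v \<sigma> (w j) = v} = {}"
            using uniq[OF that(1)] that(2) by (auto simp: orbit_of_def)
          then show ?thesis using t[OF that(1)] by simp
        qed
        ultimately have "(\<Sum>j<g. ?t j) = (\<Sum>j<g. if j = k then Poly_Mapping.lookup x v else 0)"
          by (intro sum.cong) auto
        then show ?thesis using k(1) by simp
      next
        case False
        then have "Poly_Mapping.lookup x v = 0" using x by (simp add: in_chains_iff)
        then show ?thesis using False by (simp add: lookup_chain_scale single_in)
      qed
      then show "Poly_Mapping.lookup (\<Sum>j<g. chain_scale act\<^sub>v (chain_coord act\<^sub>v (w j) x)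
          (Poly_Mapping.single (w j) 1)) v = Poly_Mapping.lookup x v"
        by (simp add: lookup_sum)
    qed
  qed (auto simp: single_in)
qed

text \<open>The coefficient at \<open>\<sigma>\<close> counts edges from \<open>w\<close> to the
  translate of \<open>v\<close> by \<open>\<sigma>\<close>. Translating by \<open>-\<sigma>\<close>
  gives edges ending at \<open>v\<close>, as in \<open>ell\<close>, whose summation index is the
  inverse of the group element it multiplies.\<close>

lemma chain_coord_adj_op:
  assumes "v \<in> verts Y" "w \<in> verts Y"
  shows "chain_coord act\<^sub>v v (adj_op Y (Poly_Mapping.single w 1)) = ell Y act\<^sub>v v w"
proof (rule poly_mapping_eqI)
  fix \<sigma>
  let ?c = "1 / of_nat (card (stab act\<^sub>v v)) :: complex"
  have "Poly_Mapping.single w (1::complex) \<in> chains Y" using assms by (simp add: chains_def)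
  then have "Poly_Mapping.lookup (adj_op Y (Poly_Mapping.single w 1)) (act\<^sub>v \<sigma> v)
      = of_nat (adj_count Y (act\<^sub>v \<sigma> v) w)"
    using assms finite_verts by (simp add: lookup_adj_op lookup_single when_def if_distrib
        [of "\<lambda>c. c * _"] cong: if_cong)
  also have "adj_count Y (act\<^sub>v \<sigma> v) w = adj_count Y v (act\<^sub>v (- \<sigma>) w)"
    using adj_count_act[of "act\<^sub>v \<sigma> v" w "- \<sigma>"] assms by (simp add: act\<^sub>v_in)
  finally have l: "Poly_Mapping.lookup (chain_coord act\<^sub>v v (adj_op Y (Poly_Mapping.single w 1))) \<sigma>
      = ?c * of_nat (adj_count Y v (act\<^sub>v (- \<sigma>) w))"
    by (simp add: lookup_chain_coord)
  have "ell Y act\<^sub>v v w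
      = (\<Sum>\<tau>\<in>UNIV. Poly_Mapping.single (- \<tau>) (?c * of_nat (adj_count Y v (act\<^sub>v \<tau> w))))"
    unfolding ell_def by (simp add: sum_distrib_left mult_single del: single_of_nat)
  also have "\<dots> = (\<Sum>\<tau>\<in>UNIV. Poly_Mapping.single \<tau> (?c * of_nat (adj_count Y v (act\<^sub>v (- \<tau>) w))))"
    by (rule sum.reindex_bij_witness[of _ uminus uminus]) auto
  finally show "Poly_Mapping.lookup (chain_coord act\<^sub>v v (adj_op Y (Poly_Mapping.single w 1))) \<sigma>
      = Poly_Mapping.lookup (ell Y act\<^sub>v v w) \<sigma>"
    by (simp add: l lookup_sum lookup_single when_def)
qed

text \<open>The vertex \<open>w\<close> is an eigenvector of \<open>Q_op Y\<close> with eigenvalue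
  \<open>val Y w - 1\<close>, so the coefficient at \<open>\<sigma>\<close> is nonzero only if
  \<open>\<sigma>\<close> carries \<open>v\<close> to \<open>w\<close>. For \<open>v = w\<close>
  these are the stabilizer elements, which give the idempotent; otherwise \<open>sep\<close>
  excludes them all.\<close>

lemma chain_coord_Q_op:
  assumes "v \<in> verts Y" "w \<in> verts Y" and sep: "w \<in> orbit_of act\<^sub>v v \<Longrightarrow> w = v"
  shows "chain_coord act\<^sub>v v (Q_op Y (Poly_Mapping.single w 1))
    = (if v = w then gr_scalar (of_nat (val Y v) - 1) * stab_idem act\<^sub>v v else 0)"
proof (rule poly_mapping_eqI)
  fix \<sigma>
  let ?c = "1 / of_nat (card (stab act\<^sub>v v)) :: complex"
  have "Poly_Mapping.single w (1::complex) \<in> chains Y" using assms by (simp add: chains_def)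
  then have l: "Poly_Mapping.lookup (chain_coord act\<^sub>v v (Q_op Y (Poly_Mapping.single w 1))) \<sigma>
      = (if act\<^sub>v \<sigma> v = w then (of_nat (val Y w) - 1) * ?c else 0)"
    by (simp add: lookup_chain_coord Q_op_def lookup_minus lookup_val_op lookup_single when_def
        diff_divide_distrib)
  have idem: "gr_scalar (of_nat (val Y v) - 1) * stab_idem act\<^sub>v v
      = (\<Sum>\<tau>\<in>stab act\<^sub>v v. Poly_Mapping.single \<tau> ((of_nat (val Y v) - 1) * ?c))"
    unfolding stab_idem_def by (simp add: sum_distrib_left mult_single del: single_diff)
  show "Poly_Mapping.lookup (chain_coord act\<^sub>v v (Q_op Y (Poly_Mapping.single w 1))) \<sigma>
    = Poly_Mapping.lookup
      (if v = w then gr_scalar (of_nat (val Y v) - 1) * stab_idem act\<^sub>v v else 0) \<sigma>"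
  proof (cases "v = w")
    case True
    then show ?thesis
      unfolding l idem by (simp add: lookup_sum lookup_single when_def) (simp add: stab_def)
  next
    case False
    then have "act\<^sub>v \<sigma> v \<noteq> w" using sep by (auto simp: orbit_of_def)
    then show ?thesis using False unfolding l by simp
  qed
qed

end

section \<open>From orbit representatives to the determinant over the polynomial ring\<close>

theorem theorem4p6:
  fixes Y :: "('v, 'e) sgraph"
    and act\<^sub>v :: "'g::{ab_group_add,finite} \<Rightarrow> 'v \<Rightarrow> 'v"
    and act\<^sub>e :: "'g \<Rightarrow> 'e \<Rightarrow> 'e"
    and g :: nat
    and v :: "nat \<Rightarrow> 'v set"
    and w :: "nat \<Rightarrow> 'v"
  assumes "finite_serre_graph Y"
    and "graph_action_without_inversion Y act\<^sub>v act\<^sub>e"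
    and "bij_betw v {..<g} (verts (quotient_graph Y act\<^sub>v act\<^sub>e))"
    and "\<And>i. i < g \<Longrightarrow> w i \<in> verts Y \<and> orbit_of act\<^sub>v (w i) = v i"
  shows "eta Y act\<^sub>v =
    det (1\<^sub>m g - monom 1 1 \<cdot>\<^sub>m map_mat (\<lambda>a. [:a:]) (A_mat Y act\<^sub>v g w)
              + monom 1 2 \<cdot>\<^sub>m map_mat (\<lambda>a. [:a:]) (Q_mat Y act\<^sub>v g w))"
proof -
  interpret finite_serre_graph Y by fact
  interpret graph_action_without_inversion Y act\<^sub>v act\<^sub>e by fact
  interpret finite_graph_action Y act\<^sub>v act\<^sub>e by unfold_locales
  have w_in: "w i \<in> verts Y" and w_orbit: "orbit_of act\<^sub>v (w i) = v i" if "i < g" for i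
    using assms(4)[OF that] by auto
  have self_orbit: "x \<in> orbit_of act\<^sub>v x" if "x \<in> verts Y" for x
    using that act\<^sub>v_zero unfolding orbit_of_def by (metis rangeI)
  have orbit_eq: "orbit_of act\<^sub>v x = orbit_of act\<^sub>v y"
    if y: "y \<in> verts Y" and x: "x \<in> orbit_of act\<^sub>v y" for x y
  proof -
    obtain \<tau> where \<tau>: "x = act\<^sub>v \<tau> y" using x by (auto simp: orbit_of_def)
    have "act\<^sub>v \<sigma> x = act\<^sub>v (\<sigma> + \<tau>) y" for \<sigma>
      using y by (simp add: \<tau> act\<^sub>v_add)
    then have "orbit_of act\<^sub>v x \<subseteq> orbit_of act\<^sub>v y"
      by (auto simp: orbit_of_def)
    moreover have "act\<^sub>v \<sigma> y = act\<^sub>v (\<sigma> - \<tau>) x" for \<sigma>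
      using y by (simp add: \<tau> act\<^sub>v_add[symmetric])
    then have "orbit_of act\<^sub>v y \<subseteq> orbit_of act\<^sub>v x"
      by (auto simp: orbit_of_def)
    ultimately show ?thesis by (rule equalityI)
  qed
  have v_inj: "i = j" if "i < g" "j < g" "v i = v j" for i j
    using assms(3) that by (auto simp: bij_betw_def inj_on_def)
  \<comment> \<open>Surjectivity of \<open>v\<close> onto the orbits gives existence of the
    representative, and injectivity its uniqueness.\<close>
  have cover: "\<exists>!i. i < g \<and> x \<in> orbit_of act\<^sub>v (w i)" if x: "x \<in> verts Y" for x
  proof -
    have "orbit_of act\<^sub>v x \<in> v ` {..<g}"
      using assms(3) x by (simp add: bij_betw_def quotient_graph_def)
    then obtain i where i: "i < g" "orbit_of act\<^sub>v x = v i" by auto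
    show ?thesis
    proof (rule ex1I[of _ i])
      show "i < g \<and> x \<in> orbit_of act\<^sub>v (w i)"
        using i w_orbit self_orbit[OF x] by simp
      fix j assume "j < g \<and> x \<in> orbit_of act\<^sub>v (w j)"
      then show "j = i" using orbit_eq[of "w j" x] w_in w_orbit i v_inj by auto
    qed
  qed
  let ?p = "\<lambda>j. Poly_Mapping.single (w j) (1::complex)"
  let ?\<phi> = "\<lambda>i. chain_coord act\<^sub>v (w i)"
  interpret B: dual_basis "chains Y" "chain_scale act\<^sub>v" g ?p ?\<phi>
    by (rule dual_basis_chains[OF w_in cover])
  interpret A: module_endo "chains Y" "chain_scale act\<^sub>v" "adj_op Y" by (rule module_endo_adj_op)
  interpret Q: module_endo "chains Y" "chain_scale act\<^sub>v" "Q_op Y" by (rule module_endo_Q_op)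
  have "module_endo (poly_set (chains Y)) (poly_scale (chain_scale act\<^sub>v)) (Delta_op Y)"
    unfolding Delta_op_def[abs_def]
    by (intro module_endo_add module_endo_diff module_endo_id B.module_on_poly
        module_endo_comp[OF B.module_endo_pCons_zero] A.module_endo_map_poly Q.module_endo_map_poly)
  moreover have "poly_chains Y = poly_set (chains Y)"
    by (simp add: poly_chains_def poly_set_def)
  moreover have "poly_chain_scale act\<^sub>v = poly_scale (chain_scale act\<^sub>v)"
    by (intro ext) (simp add: poly_chain_scale_def poly_scale_def)
  ultimately have "eta Y act\<^sub>v
      = det (endo_mat g (\<lambda>j. [:?p j:]) (\<lambda>i. map_poly (?\<phi> i)) (Delta_op Y))"
    unfolding eta_def by (simp add: proj_det_eq_det_endo_mat[OF _ B.dual_basis_poly])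
  also have "endo_mat g (\<lambda>j. [:?p j:]) (\<lambda>i. map_poly (?\<phi> i)) (Delta_op Y)
      = 1\<^sub>m g - monom 1 1 \<cdot>\<^sub>m map_mat (\<lambda>a. [:a:]) (A_mat Y act\<^sub>v g w)
              + monom 1 2 \<cdot>\<^sub>m map_mat (\<lambda>a. [:a:]) (Q_mat Y act\<^sub>v g w)" (is "?L = ?R")
  proof (rule eq_matI)
    fix i j assume "i < dim_row ?R" "j < dim_col ?R"
    then have i: "i < g" and j: "j < g" by (simp_all add: Q_mat_def)
    have \<phi>_uminus: "?\<phi> i (- x) = - ?\<phi> i x" if "x \<in> chains Y" for x
      using B.coord_diff[OF i B.zero_in that] B.coord_zero[OF i] by simp
    \<comment> \<open>Subtracting the identity removes the constant term of
      \<open>\<Delta>(u)\<close>. Hence the idempotents \<open>?\<phi> i (?p i)\<close> do not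
      appear in degree 0, and the constant term of the matrix is the full identity contributed by
      \<open>endo_mat\<close>.\<close>
    have "map_poly (?\<phi> i) (Delta_op Y [:?p j:] - [:?p j:])
        = map_poly (?\<phi> i) [:0, - adj_op Y (?p j), Q_op Y (?p j):]"
      by (simp add: Delta_op_def map_poly_pCons A.endo_zero Q.endo_zero)
    also have "\<dots> = [:0, - ?\<phi> i (adj_op Y (?p j)), ?\<phi> i (Q_op Y (?p j)):]"
      by (simp add: map_poly_pCons B.coord_zero[OF i] \<phi>_uminus A.endo_in B.p_in[OF j])
    also have "?\<phi> i (adj_op Y (?p j)) = ell Y act\<^sub>v (w i) (w j)"
      by (rule chain_coord_adj_op[OF w_in[OF i] w_in[OF j]])
    also have "?\<phi> i (Q_op Y (?p j)) = (if i = j then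
        gr_scalar (of_nat (val Y (w i)) - 1) * stab_idem act\<^sub>v (w i) else 0)"
    proof -
      \<comment> \<open>Distinct indices label distinct orbits, so this provides \<open>sep\<close>
        for the coordinate of \<open>Q_op Y\<close> and lets the case \<open>w i = w j\<close> be
        read as \<open>i = j\<close>.\<close>
      have "i = j" if "w j \<in> orbit_of act\<^sub>v (w i)"
        using orbit_eq[OF w_in[OF i] that] w_orbit i j v_inj by metis
      moreover from this have "w i = w j \<longleftrightarrow> i = j"
        using self_orbit[OF w_in[OF j]] by metis
      ultimately show ?thesis
        by (subst chain_coord_Q_op) (auto simp: w_in i j)
    qed
    finally have e: "map_poly (?\<phi> i) (Delta_op Y [:?p j:] - [:?p j:])
        = [:0, - A_mat Y act\<^sub>v g w $$ (i, j), Q_mat Y act\<^sub>v g w $$ (i, j):]"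
      using i j by (simp add: A_mat_def Q_mat_def)
    have "monom 1 1 * [:a:] = [:0, a:]" "monom 1 2 * [:a:] = [:0, 0, a:]" for a :: "'g group_ring"
      by (simp_all add: monom_Suc numeral_2_eq_2 monom_0)
    then show "?L $$ (i, j) = ?R $$ (i, j)"
      using i j by (simp add: endo_mat_def e) (simp add: A_mat_def Q_mat_def)
  qed (simp_all add: endo_mat_def Q_mat_def)
  finally show ?thesis .
qed

end
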